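(* Let $\dot q=f_0(q)+u_1f_1(q)+u_2f_2(q)$, $u_1,u_2\in\mathbb R$, be a control-affine system on a $4$-dimensional manifold $M$. The set ${\rm Ext}(q)$ is an affine line, provided that $\dim D_2^2=3$ and $\dim[V,D_2](q)=4$.
   Context: All objects are $C^\infty$; $f_0,f_1,f_2$ are linearly independent. $V(q)=\{f_0(q)+u_1f_1(q)+u_2f_2(q):u_1,u_2\in\mathbb R\}$, $D_2={\rm span}(f_1,f_2)$, $D_2^2=D_2+[D_2,D_2]$, and $[V,D_2](q)=\{[X,Y](q):X\in V,\ Y\in D_2\text{ vector fields}\}$, which is a linear space equal to ${\rm span}(f_1(q),f_2(q),[f_1,f_2](q),[f_0,f_1](q),[f_0,f_2](q))$. On $T^*M$ put $h_i(p,q)=p\cdot f_i(q)$, $i=0,1,2$, with Poisson brackets $\{h_i,h_j\}(p,q)=p\cdot[f_i,f_j](q)$; $\vec h$ is the Hamiltonian vector field of $h$ and $\pi:T^*M\to M$ the projection (so $\pi_*\vec h_i=f_i$); $D^\perp\subset T^*M$ denotes the annihilator of a distribution $D$. On $(D_2)^\perp\setminus(D_2^2)^\perp$ let $$\vec X=\vec h_0+\frac{\{h_0,h_2\}}{\{h_2,h_1\}}\vec h_1+\frac{\{h_1,h_0\}}{\{h_2,h_1\}}\vec h_2$$ (its integral curves are the extremals of the time optimal problem lying in this set), and $${\rm Ext}(q)=\{\pi_*\vec X(\lambda):\lambda\in T_q^*M\cap(D_2)^\perp\setminus(D_2^2)^\perp\}\subset V(q).$$ *)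

theory Defs
  imports "HOL-Analysis.Analysis" "HOL-Library.Function_Algebras"
begin

section \<open>Pointwise vector space structure on functions\<close>

text \<open>Tangent vectors are operators on functions, so this instance makes \<^const>\<open>span\<close>,
  \<^const>\<open>dim\<close>, \<^const>\<open>hull\<close>, etc. available for them.\<close>

instantiation "fun" :: (type, scaleR) scaleR
begin
definition scaleR_fun_def: "c *\<^sub>R f = (\<lambda>x. c *\<^sub>R f x)"
instance ..
end

instance "fun" :: (type, real_vector) real_vector
  by standard
    (simp_all add: scaleR_fun_def plus_fun_def scaleR_add_right scaleR_add_left)

section \<open>Smooth manifolds\<close>

text \<open>\<^emph>\<open>C_on k S f\<close> is meant for open \<^term>\<open>S\<close>: \<^term>\<open>f\<close> is \<^term>\<open>k\<close> times continuously
  differentiable on \<^term>\<open>S\<close>.\<close>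

fun C_on :: "nat \<Rightarrow> 'a::euclidean_space set \<Rightarrow> ('a \<Rightarrow> 'b::real_normed_vector) \<Rightarrow> bool" where
  "C_on 0 S f \<longleftrightarrow> continuous_on S f"
| "C_on (Suc k) S f \<longleftrightarrow>
     (\<forall>x\<in>S. f differentiable (at x)) \<and>
     (\<forall>v. C_on k S (\<lambda>x. frechet_derivative f (at x) v))"

definition smooth_on :: "'a::euclidean_space set \<Rightarrow> ('a \<Rightarrow> 'b::real_normed_vector) \<Rightarrow> bool" where
  "smooth_on S f \<longleftrightarrow> (\<forall>k. C_on k S f)"

text \<open>A chart is a domain together with a coordinate map, of which only the values on the
  domain matter.\<close>

type_synonym ('m, 'e) chart = "'m set \<times> ('m \<Rightarrow> 'e)"

definition chart_inv :: "('m, 'e) chart \<Rightarrow> 'e \<Rightarrow> 'm" where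
  "chart_inv c = inv_into (fst c) (snd c)"

definition smooth_manifold ::
    "'m topology \<Rightarrow> ('m, 'e::euclidean_space) chart set \<Rightarrow> bool" where
  "smooth_manifold M A \<longleftrightarrow>
     Hausdorff_space M \<and> second_countable M \<and>
     (\<Union>(U, \<phi>)\<in>A. U) = topspace M \<and>
     (\<forall>(U, \<phi>)\<in>A. openin M U \<and> open (\<phi> ` U) \<and>
        homeomorphic_map (subtopology M U) (top_of_set (\<phi> ` U)) \<phi>) \<and>
     (\<forall>(U, \<phi>)\<in>A. \<forall>(W, \<psi>)\<in>A. smooth_on (\<phi> ` (U \<inter> W)) (\<psi> \<circ> chart_inv (U, \<phi>)))"

text \<open>The notions below depend only on the atlas, so that they also apply to the cotangent
  bundle with the atlas induced from the base. \<^emph>\<open>smooth_at A q f\<close> says that \<^term>\<open>f\<close> is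
  smooth on a neighbourhood of \<^term>\<open>q\<close>.\<close>

definition smooth_at ::
    "('m, 'e::euclidean_space) chart set \<Rightarrow> 'm \<Rightarrow> ('m \<Rightarrow> real) \<Rightarrow> bool" where
  "smooth_at A q f \<longleftrightarrow>
     (\<exists>c\<in>A. q \<in> fst c \<and>
        (\<exists>W. open W \<and> snd c q \<in> W \<and> W \<subseteq> snd c ` fst c \<and> smooth_on W (f \<circ> chart_inv c)))"

definition smooth_curve :: "('m, 'e::euclidean_space) chart set \<Rightarrow> (real \<Rightarrow> 'm) \<Rightarrow> bool" where
  "smooth_curve A \<gamma> \<longleftrightarrow>
     (\<exists>c\<in>A. \<exists>\<epsilon>>0. \<gamma> ` {-\<epsilon><..<\<epsilon>} \<subseteq> fst c \<and> smooth_on {-\<epsilon><..<\<epsilon>} (snd c \<circ> \<gamma>))"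

text \<open>A tangent vector at \<^term>\<open>q\<close> is the velocity of a curve through \<^term>\<open>q\<close>, regarded as a
  derivation of the functions that are smooth near \<^term>\<open>q\<close>. By convention it is 0 on all other
  functions; this makes equality of tangent vectors the equality of operators.\<close>

type_synonym 'm tangent = "('m \<Rightarrow> real) \<Rightarrow> real"

definition velocity ::
    "('m, 'e::euclidean_space) chart set \<Rightarrow> (real \<Rightarrow> 'm) \<Rightarrow> 'm tangent" where
  "velocity A \<gamma> = (\<lambda>f. if smooth_at A (\<gamma> 0) f then deriv (\<lambda>t. f (\<gamma> t)) 0 else 0)"

definition tangent_space ::
    "('m, 'e::euclidean_space) chart set \<Rightarrow> 'm \<Rightarrow> 'm tangent set" where
  "tangent_space A q = {velocity A \<gamma> | \<gamma>. smooth_curve A \<gamma> \<and> \<gamma> 0 = q}"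

text \<open>The constant coordinate vector \<^term>\<open>e\<close> of the chart \<^term>\<open>c\<close>, at the point \<^term>\<open>q\<close>:
  for \<^term>\<open>e\<close> in \<^const>\<open>Basis\<close> these are the usual partial derivatives at \<^term>\<open>q\<close>.\<close>

definition coord_vector ::
    "('m, 'e::euclidean_space) chart set \<Rightarrow> ('m, 'e) chart \<Rightarrow> 'm \<Rightarrow> 'e \<Rightarrow> 'm tangent" where
  "coord_vector A c q e = velocity A (\<lambda>t. chart_inv c (snd c q + t *\<^sub>R e))"

definition pushforward ::
    "('n, 'd::euclidean_space) chart set \<Rightarrow> ('m \<Rightarrow> 'n) \<Rightarrow> 'm \<Rightarrow> 'm tangent \<Rightarrow> 'n tangent" where
  "pushforward B F q v = (\<lambda>f. if smooth_at B (F q) f then v (f \<circ> F) else 0)"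

section \<open>Vector fields and distributions\<close>

definition smooth_vector_field ::
    "('m, 'e::euclidean_space) chart set \<Rightarrow> ('m \<Rightarrow> 'm tangent) \<Rightarrow> bool" where
  "smooth_vector_field A X \<longleftrightarrow>
     (\<forall>q\<in>\<Union>(fst ` A). X q \<in> tangent_space A q \<and>
        (\<forall>f. smooth_at A q f \<longrightarrow> smooth_at A q (\<lambda>x. X x f)))"

definition lie_bracket ::
    "('m, 'e::euclidean_space) chart set \<Rightarrow> ('m \<Rightarrow> 'm tangent) \<Rightarrow> ('m \<Rightarrow> 'm tangent)
       \<Rightarrow> 'm \<Rightarrow> 'm tangent" where
  "lie_bracket A X Y q =
     (\<lambda>f. if smooth_at A q f then X q (\<lambda>x. Y x f) - Y q (\<lambda>x. X x f) else 0)"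

definition vector_fields_in ::
    "('m, 'e::euclidean_space) chart set \<Rightarrow> ('m \<Rightarrow> 'm tangent set) \<Rightarrow> ('m \<Rightarrow> 'm tangent) set" where
  "vector_fields_in A E = {X. smooth_vector_field A X \<and> (\<forall>x\<in>\<Union>(fst ` A). X x \<in> E x)}"

definition bracket_of ::
    "('m, 'e::euclidean_space) chart set \<Rightarrow> ('m \<Rightarrow> 'm tangent set) \<Rightarrow> ('m \<Rightarrow> 'm tangent set)
       \<Rightarrow> 'm \<Rightarrow> 'm tangent set" where
  "bracket_of A E F q =
     {lie_bracket A X Y q | X Y. X \<in> vector_fields_in A E \<and> Y \<in> vector_fields_in A F}"

section \<open>The cotangent bundle\<close>

text \<open>Covectors are linear forms on the tangent space, extended by 0 outside of it.\<close>

type_synonym 'm cotangent = "'m tangent \<Rightarrow> real"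

definition cotangent_space ::
    "('m, 'e::euclidean_space) chart set \<Rightarrow> 'm \<Rightarrow> 'm cotangent set" where
  "cotangent_space A q =
     {p. (\<forall>v\<in>tangent_space A q. \<forall>w\<in>tangent_space A q. p (v + w) = p v + p w) \<and>
         (\<forall>v\<in>tangent_space A q. \<forall>a. p (a *\<^sub>R v) = a * p v) \<and>
         (\<forall>v. v \<notin> tangent_space A q \<longrightarrow> p v = 0)}"

definition cotangent_bundle ::
    "('m, 'e::euclidean_space) chart set \<Rightarrow> ('m \<times> 'm cotangent) set" where
  "cotangent_bundle A = (SIGMA q:\<Union>(fst ` A). cotangent_space A q)"

text \<open>The canonical coordinates \<open>(x, \<xi>)\<close> on the cotangent bundle, positions first.\<close>

definition cotangent_chart ::
    "('m, 'e::euclidean_space) chart set \<Rightarrow> ('m, 'e) chart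
       \<Rightarrow> ('m \<times> 'm cotangent, 'e \<times> 'e) chart" where
  "cotangent_chart A c =
     (SIGMA q:fst c. cotangent_space A q,
      \<lambda>(q, p). (snd c q, \<Sum>b\<in>Basis. p (coord_vector A c q b) *\<^sub>R b))"

definition cotangent_atlas ::
    "('m, 'e::euclidean_space) chart set \<Rightarrow> ('m \<times> 'm cotangent, 'e \<times> 'e) chart set" where
  "cotangent_atlas A = cotangent_chart A ` A"

definition annihilator ::
    "('m, 'e::euclidean_space) chart set \<Rightarrow> ('m \<Rightarrow> 'm tangent set) \<Rightarrow> ('m \<times> 'm cotangent) set" where
  "annihilator A E = {(q, p). (q, p) \<in> cotangent_bundle A \<and> (\<forall>v\<in>E q. p v = 0)}"

text \<open>The Hamiltonian vector field
  \<open>\<Sum>\<^sub>b (\<partial>h/\<partial>\<xi>\<^sub>b) \<partial>/\<partial>x\<^sub>b - (\<partial>h/\<partial>x\<^sub>b) \<partial>/\<partial>\<xi>\<^sub>b\<close> in canonical coordinates. Changes of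
  canonical coordinates are symplectic, so for smooth \<^term>\<open>h\<close> the choice of the chart of
  the base is immaterial.\<close>

definition hamiltonian_field ::
    "('m, 'e::euclidean_space) chart set \<Rightarrow> ('m \<times> 'm cotangent \<Rightarrow> real)
       \<Rightarrow> 'm \<times> 'm cotangent \<Rightarrow> ('m \<times> 'm cotangent) tangent" where
  "hamiltonian_field A h l =
     (let c = (SOME c. c \<in> A \<and> fst l \<in> fst c);
          D = coord_vector (cotangent_atlas A) (cotangent_chart A c) l
      in \<Sum>b\<in>Basis. D (0, b) h *\<^sub>R D (b, 0) - D (b, 0) h *\<^sub>R D (0, b))"

text \<open>The sign is such that the bracket of the fibrewise linear Hamiltonians of two vector
  fields is the Hamiltonian of their Lie bracket.\<close>

definition poisson_bracket ::
    "('m, 'e::euclidean_space) chart set \<Rightarrow> ('m \<times> 'm cotangent \<Rightarrow> real)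
       \<Rightarrow> ('m \<times> 'm cotangent \<Rightarrow> real) \<Rightarrow> 'm \<times> 'm cotangent \<Rightarrow> real" where
  "poisson_bracket A g h l = hamiltonian_field A g l h"

definition vf_hamiltonian :: "('m \<Rightarrow> 'm tangent) \<Rightarrow> 'm \<times> 'm cotangent \<Rightarrow> real" where
  "vf_hamiltonian X = (\<lambda>(q, p). p (X q))"

section \<open>Control-affine systems with two controls\<close>

definition affine_system ::
    "('m, 'e::euclidean_space) chart set \<Rightarrow> ('m \<Rightarrow> 'm tangent) \<Rightarrow> ('m \<Rightarrow> 'm tangent)
       \<Rightarrow> ('m \<Rightarrow> 'm tangent) \<Rightarrow> bool" where
  "affine_system A f0 f1 f2 \<longleftrightarrow>
     smooth_vector_field A f0 \<and> smooth_vector_field A f1 \<and> smooth_vector_field A f2 \<and>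
     (\<forall>q\<in>\<Union>(fst ` A). distinct [f0 q, f1 q, f2 q] \<and> independent {f0 q, f1 q, f2 q})"

definition velocity_set ::
    "('m \<Rightarrow> 'm tangent) \<Rightarrow> ('m \<Rightarrow> 'm tangent) \<Rightarrow> ('m \<Rightarrow> 'm tangent) \<Rightarrow> 'm \<Rightarrow> 'm tangent set" where
  "velocity_set f0 f1 f2 q = {f0 q + u1 *\<^sub>R f1 q + u2 *\<^sub>R f2 q | u1 u2. True}"

definition D2 :: "('m \<Rightarrow> 'm tangent) \<Rightarrow> ('m \<Rightarrow> 'm tangent) \<Rightarrow> 'm \<Rightarrow> 'm tangent set" where
  "D2 f1 f2 q = span {f1 q, f2 q}"

definition D2_sq ::
    "('m, 'e::euclidean_space) chart set \<Rightarrow> ('m \<Rightarrow> 'm tangent) \<Rightarrow> ('m \<Rightarrow> 'm tangent)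
       \<Rightarrow> 'm \<Rightarrow> 'm tangent set" where
  "D2_sq A f1 f2 q =
     {v + w | v w. v \<in> D2 f1 f2 q \<and> w \<in> bracket_of A (D2 f1 f2) (D2 f1 f2) q}"

definition extremal_field ::
    "('m, 'e::euclidean_space) chart set \<Rightarrow> ('m \<Rightarrow> 'm tangent) \<Rightarrow> ('m \<Rightarrow> 'm tangent)
       \<Rightarrow> ('m \<Rightarrow> 'm tangent) \<Rightarrow> 'm \<times> 'm cotangent \<Rightarrow> ('m \<times> 'm cotangent) tangent" where
  "extremal_field A f0 f1 f2 l =
     (let h0 = vf_hamiltonian f0; h1 = vf_hamiltonian f1; h2 = vf_hamiltonian f2
      in hamiltonian_field A h0 l
         + (poisson_bracket A h0 h2 l / poisson_bracket A h2 h1 l) *\<^sub>R hamiltonian_field A h1 l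
         + (poisson_bracket A h1 h0 l / poisson_bracket A h2 h1 l) *\<^sub>R hamiltonian_field A h2 l)"

definition Ext ::
    "('m, 'e::euclidean_space) chart set \<Rightarrow> ('m \<Rightarrow> 'm tangent) \<Rightarrow> ('m \<Rightarrow> 'm tangent)
       \<Rightarrow> ('m \<Rightarrow> 'm tangent) \<Rightarrow> 'm \<Rightarrow> 'm tangent set" where
  "Ext A f0 f1 f2 q =
     {pushforward A fst l (extremal_field A f0 f1 f2 l) | l.
        fst l = q \<and> l \<in> annihilator A (D2 f1 f2) - annihilator A (D2_sq A f1 f2)}"

definition affine_line :: "'v::real_vector set \<Rightarrow> bool" where
  "affine_line S \<longleftrightarrow> (\<exists>a d. d \<noteq> 0 \<and> S = {a + t *\<^sub>R d | t. True})"

end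

theory Submission
  imports Defs
begin

text \<open>In a chart around \<open>q\<close>, identify tangent vectors and covectors at \<open>q\<close> with vectors of the
  coordinate space. Since the Hamiltonian field of \<open>h\<^sub>i\<close> projects to \<open>f\<^sub>i\<close> and Poisson brackets of
  the \<open>h\<^sub>i\<close> are pairings with Lie brackets, \<open>Ext(q)\<close> consists of the points
  \<open>f\<^sub>0 - (p g\<^sub>2 / p w) f\<^sub>1 + (p g\<^sub>1 / p w) f\<^sub>2\<close> with \<open>w = [f\<^sub>1, f\<^sub>2]\<close>, \<open>g\<^sub>i = [f\<^sub>0, f\<^sub>i]\<close>, where \<open>p\<close> kills
  \<open>f\<^sub>1, f\<^sub>2\<close> but not \<open>w\<close>. The dimension hypotheses say that \<open>f\<^sub>1, f\<^sub>2, w\<close> are independent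
  and that some \<open>g \<in> {g\<^sub>1, g\<^sub>2}\<close> completes them to a basis. Modulo \<open>f\<^sub>1, f\<^sub>2\<close> we have
  \<open>g\<^sub>i = \<alpha>\<^sub>i w + \<beta>\<^sub>i g\<close> with \<open>(\<beta>\<^sub>1, \<beta>\<^sub>2) \<noteq> 0\<close>, and the ratio \<open>t = p g / p w\<close> is arbitrary, so the points
  run over a line with direction \<open>\<beta>\<^sub>1 f\<^sub>2 - \<beta>\<^sub>2 f\<^sub>1\<close>.\<close>

section \<open>Smooth functions on open sets\<close>

lemma linear_Basis_expansion:
  fixes h :: "'a::euclidean_space \<Rightarrow> 'b::real_vector"
  assumes "linear h"
  shows "h v = (\<Sum>b\<in>Basis. (v \<bullet> b) *\<^sub>R h b)"
proof -
  have "h v = h (\<Sum>b\<in>Basis. (v \<bullet> b) *\<^sub>R b)" by (simp add: euclidean_representation)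
  also have "\<dots> = (\<Sum>b\<in>Basis. (v \<bullet> b) *\<^sub>R h b)"
    by (simp add: linear_sum[OF assms] linear_scale[OF assms])
  finally show ?thesis .
qed

text \<open>At a point of an open set, \<open>f\<close> and \<open>g\<close> have the same
  derivatives, if any. Hence \<open>frechet_derivative\<close>, a choice among them, gives the same
  result for both even where neither is differentiable, and the induction goes through.\<close>

lemma C_on_cong:
  assumes "open S" "\<And>x. x \<in> S \<Longrightarrow> f x = g x"
  shows "C_on k S f \<longleftrightarrow> C_on k S g"
  using assms(2)
proof (induction k arbitrary: f g)
  case 0
  then show ?case by (auto intro: continuous_on_cong)
next
  case (Suc k)
  have d: "(f has_derivative D) (at x) \<longleftrightarrow> (g has_derivative D) (at x)" if "x \<in> S" for x D
    using that Suc.prems assms(1)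
    by (metis has_derivative_transform_within_open)
  have "frechet_derivative f (at x) = frechet_derivative g (at x)" if "x \<in> S" for x
    unfolding frechet_derivative_def using d[OF that] by simp
  moreover have "f differentiable (at x) \<longleftrightarrow> g differentiable (at x)" if "x \<in> S" for x
    unfolding differentiable_def using d[OF that] by simp
  ultimately show ?case
    using Suc.IH[of "\<lambda>x. frechet_derivative f (at x) v" "\<lambda>x. frechet_derivative g (at x) v" for v]
    by auto
qed

lemma C_on_subset: "C_on k S f \<Longrightarrow> T \<subseteq> S \<Longrightarrow> C_on k T f"
  by (induction k arbitrary: f) (auto intro: continuous_on_subset)

lemma C_on_Suc_imp: "C_on (Suc k) S f \<Longrightarrow> C_on k S f"
proof (induction k arbitrary: f)
  case 0
  then show ?case
    by (auto intro!: continuous_at_imp_continuous_on differentiable_imp_continuous_within)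
next
  case (Suc k)
  then show ?case by (metis C_on.simps(2))
qed

text \<open>Needed for gluing: \<open>smooth_at\<close> yields a neighbourhood that varies with the
  point.\<close>

lemma C_on_locally:
  assumes "open S" "\<And>x. x \<in> S \<Longrightarrow> \<exists>T. open T \<and> x \<in> T \<and> C_on k T f"
  shows "C_on k S f"
  using assms(2)
proof (induction k arbitrary: f)
  case 0
  show ?case
    unfolding C_on.simps
  proof (rule continuous_at_imp_continuous_on, rule ballI)
    fix x assume "x \<in> S"
    with 0 obtain T where "open T" "x \<in> T" "C_on 0 T f" by blast
    then show "isCont f x" by (simp add: continuous_on_eq_continuous_at)
  qed
next
  case (Suc k)
  show ?case
    unfolding C_on.simps
  proof (intro conjI ballI allI)
    fix x assume "x \<in> S"
    with Suc.prems obtain T where "x \<in> T" "C_on (Suc k) T f" by blast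
    then show "f differentiable at x" by auto
  next
    fix v show "C_on k S (\<lambda>x. frechet_derivative f (at x) v)"
      using Suc.IH Suc.prems by (metis C_on.simps(2))
  qed
qed

lemma frechet_derivative_eq: "(f has_derivative D) (at x) \<Longrightarrow> frechet_derivative f (at x) = D"
  using frechet_derivative_at by metis

lemma C_on_const: "C_on k S (\<lambda>x. c)"
  by (induction k arbitrary: c) (auto simp: frechet_derivative_eq[OF has_derivative_const])

lemma C_on_bounded_linear:
  assumes "bounded_linear f" shows "C_on k S f"
proof (cases k)
  case 0
  then show ?thesis using assms by (auto simp: linear_continuous_on)
next
  case (Suc k')
  have D: "(f has_derivative f) (at x)" for x
    by (rule bounded_linear_imp_has_derivative[OF assms])
  then show ?thesis
    unfolding Suc C_on.simps frechet_derivative_eq[OF D]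
    by (auto simp: differentiable_def C_on_const)
qed

lemma C_on_Suc_has_derivative:
  "C_on (Suc k) S f \<Longrightarrow> x \<in> S \<Longrightarrow> (f has_derivative frechet_derivative f (at x)) (at x)"
  by (simp add: frechet_derivative_works[symmetric])

text \<open>Lets an explicit family of derivatives stand in for \<open>frechet_derivative\<close>,
  so that the inductions below can use the rules for \<open>has_derivative\<close>.\<close>

lemma C_on_SucI:
  assumes "open S" "\<And>x. x \<in> S \<Longrightarrow> (f has_derivative D x) (at x)"
    and "\<And>v. C_on k S (\<lambda>x. D x v)"
  shows "C_on (Suc k) S f"
  unfolding C_on.simps
proof (intro conjI ballI allI)
  fix x assume "x \<in> S" then show "f differentiable at x"
    using assms(2) differentiable_def by blast
next
  fix v show "C_on k S (\<lambda>x. frechet_derivative f (at x) v)"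
    using C_on_cong[OF assms(1), of "\<lambda>x. frechet_derivative f (at x) v" "\<lambda>x. D x v"]
      assms(2,3) frechet_derivative_eq by metis
qed

section \<open>Closure of C^k maps under sums, bilinear products and composition\<close>

lemma C_on_add:
  assumes "open S" "C_on k S f" "C_on k S g"
  shows "C_on k S (\<lambda>x. f x + g x)"
  using assms(2,3)
proof (induction k arbitrary: f g)
  case 0 then show ?case by (auto intro: continuous_on_add)
next
  case (Suc k)
  show ?case
    by (rule C_on_SucI[OF assms(1)
          has_derivative_add[OF Suc.prems[THEN C_on_Suc_has_derivative]]])
      (use Suc in auto)
qed

lemma C_on_sum:
  assumes "open S" "\<And>i. i \<in> I \<Longrightarrow> C_on k S (f i)"
  shows "C_on k S (\<lambda>x. \<Sum>i\<in>I. f i x)"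
  using assms(2) by (induction I rule: infinite_finite_induct)
    (auto simp: C_on_const intro!: C_on_add[OF assms(1)])

text \<open>By the Leibniz rule the derivative is a sum of two products under the same
  \<open>b\<close>, each with one factor differentiated; the induction hypothesis applies to both
  products.\<close>

lemma C_on_bilinear:
  assumes "bounded_bilinear b" "open S" "C_on k S f" "C_on k S g"
  shows "C_on k S (\<lambda>x. b (f x) (g x))"
  using assms(3,4)
proof (induction k arbitrary: f g)
  case 0 then show ?case
    using bounded_bilinear.continuous_on[OF assms(1)] by auto
next
  case (Suc k)
  note D = Suc.prems[THEN C_on_Suc_has_derivative]
  have D': "C_on k S (\<lambda>x. frechet_derivative f (at x) v)" "C_on k S (\<lambda>x. frechet_derivative g (at x) v)" for v
    using Suc.prems by simp_all
  show ?case
    by (rule C_on_SucI[OF assms(2) bounded_bilinear.FDERIV[OF assms(1) D]], assumption, assumption)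
      (rule C_on_add[OF assms(2) Suc.IH[OF C_on_Suc_imp[OF Suc.prems(1)] D'(2)]
        Suc.IH[OF D'(1) C_on_Suc_imp[OF Suc.prems(2)]]])
qed

text \<open>In the chain rule the direction fed to the derivative of \<open>f\<close> varies with
  the point. Expanding this direction over \<open>Basis\<close> leaves derivatives of
  \<open>f\<close> in fixed directions, composed with \<open>g\<close>, where the induction
  hypothesis applies.\<close>

lemma C_on_compose:
  fixes g :: "'a::euclidean_space \<Rightarrow> 'b::euclidean_space"
  assumes "open S" "open T" "C_on k T f" "C_on k S g" "g ` S \<subseteq> T"
  shows "C_on k S (f \<circ> g)"
  using assms(3,4)
proof (induction k arbitrary: f)
  case 0 then show ?case
    using assms(5) by (metis C_on.simps(1) continuous_on_compose continuous_on_subset)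
next
  case (Suc k)
  have gk: "C_on k S g" by (rule C_on_Suc_imp[OF Suc.prems(2)])
  have lin: "frechet_derivative f (at y) w = (\<Sum>i\<in>Basis. (w \<bullet> i) *\<^sub>R frechet_derivative f (at y) i)"
    if "y \<in> T" for y w
    using that Suc.prems(1) by (intro linear_Basis_expansion linear_frechet_derivative) auto
  show ?case
  proof (rule C_on_SucI[OF assms(1)])
    fix x assume x: "x \<in> S"
    then have gx: "g x \<in> T" using assms(5) by auto
    have "(f \<circ> g has_derivative frechet_derivative f (at (g x)) \<circ> frechet_derivative g (at x)) (at x)"
      by (rule diff_chain_at[OF C_on_Suc_has_derivative[OF Suc.prems(2) x]
            C_on_Suc_has_derivative[OF Suc.prems(1) gx]])
    then show "(f \<circ> g has_derivative (\<lambda>v. \<Sum>i\<in>Basis. (frechet_derivative g (at x) v \<bullet> i) *\<^sub>R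
        (((\<lambda>y. frechet_derivative f (at y) i) \<circ> g) x))) (at x)"
      by (simp add: o_def lin[OF gx, symmetric])
  next
    fix v
    show "C_on k S (\<lambda>x. \<Sum>i\<in>Basis. (frechet_derivative g (at x) v \<bullet> i) *\<^sub>R
        (((\<lambda>y. frechet_derivative f (at y) i) \<circ> g) x))"
    proof (intro C_on_sum C_on_bilinear[OF bounded_bilinear_scaleR] assms(1))
      fix i :: 'b
      show "C_on k S ((\<lambda>y. frechet_derivative f (at y) i) \<circ> g)"
        by (rule Suc.IH[OF _ gk]) (use Suc.prems(1) in simp)
      show "C_on k S (\<lambda>x. frechet_derivative g (at x) v \<bullet> i)"
        using C_on_bilinear[OF bounded_bilinear_inner assms(1) _ C_on_const, of k _ i] Suc.prems(2)
        by auto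
    qed
  qed
qed

section \<open>Symmetry of second derivatives\<close>

text \<open>Mean value theorem twice: along \<open>u\<close> for the increment of \<open>f\<close>
  over \<open>t *\<^sub>R v\<close>, then along \<open>v\<close> for the derivative of
  \<open>f\<close> in direction \<open>u\<close>. The distance bound drives the intermediate point
  to \<open>x\<close> as \<open>t\<close> tends to 0.\<close>

lemma C_2_mixed_difference:
  fixes f :: "'a::euclidean_space \<Rightarrow> real"
  assumes f: "C_on 2 (ball x e) f" and t: "t > 0" "t * (norm u + norm v) < e"
  shows "\<exists>y. dist y x \<le> t * (norm u + norm v) \<and>
    f (x + t *\<^sub>R u + t *\<^sub>R v) - f (x + t *\<^sub>R u) - f (x + t *\<^sub>R v) + f x
      = t * t * frechet_derivative (\<lambda>z. frechet_derivative f (at z) u) (at y) v"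
proof -
  have inb: "dist (x + a *\<^sub>R u + b *\<^sub>R v) x \<le> t * (norm u + norm v)"
    if "0 \<le> a" "a \<le> t" "0 \<le> b" "b \<le> t" for a b
  proof -
    have "dist (x + a *\<^sub>R u + b *\<^sub>R v) x = norm (a *\<^sub>R u + b *\<^sub>R v)" by (simp add: dist_norm)
    also have "\<dots> \<le> a * norm u + b * norm v"
      using norm_triangle_ineq[of "a *\<^sub>R u" "b *\<^sub>R v"] that by simp
    also have "\<dots> \<le> t * norm u + t * norm v"
      by (intro add_mono mult_right_mono that) auto
    finally show ?thesis by (simp add: algebra_simps)
  qed
  have inball: "x + a *\<^sub>R u + b *\<^sub>R v \<in> ball x e" if "0 \<le> a" "a \<le> t" "0 \<le> b" "b \<le> t" for a b
    using inb[OF that] t by (simp add: dist_commute)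
  have "C_on (Suc (Suc 0)) (ball x e) f" using f by (simp add: numeral_2_eq_2)
  then have C1: "C_on (Suc 0) (ball x e) f" and C2: "C_on (Suc 0) (ball x e) (\<lambda>z. frechet_derivative f (at z) u)"
    by (rule C_on_Suc_imp, simp)
  have d: "(g has_derivative frechet_derivative g (at y)) (at y)"
    if "C_on (Suc 0) (ball x e) g" "y \<in> ball x e" for y and g :: "'a \<Rightarrow> real"
    by (rule C_on_Suc_has_derivative[OF that])
  have line: "((\<lambda>s. g (p + s *\<^sub>R w)) has_real_derivative frechet_derivative g (at (p + s *\<^sub>R w)) w) (at s)"
    if "C_on (Suc 0) (ball x e) g" "p + s *\<^sub>R w \<in> ball x e" for g :: "'a \<Rightarrow> real" and p s w
  proof -
    have "((\<lambda>s. p + s *\<^sub>R w) has_derivative (\<lambda>h. h *\<^sub>R w)) (at s)"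
      by (auto intro!: derivative_eq_intros)
    from diff_chain_at[OF this d[OF that]]
    have "((\<lambda>s. g (p + s *\<^sub>R w)) has_derivative (\<lambda>h. frechet_derivative g (at (p + s *\<^sub>R w)) (h *\<^sub>R w))) (at s)"
      by (simp add: o_def)
    moreover have "linear (frechet_derivative g (at (p + s *\<^sub>R w)))"
      using d[OF that] has_derivative_linear by blast
    ultimately show ?thesis
      unfolding has_field_derivative_def by (simp add: linear_scale mult.commute[of _ "frechet_derivative _ _ _"])
  qed
  \<comment> \<open>The mixed second difference is \<open>\<phi> t - \<phi> 0\<close>.\<close>
  define \<phi> where "\<phi> s = f (x + t *\<^sub>R v + s *\<^sub>R u) - f (x + s *\<^sub>R u)" for s
  have "\<exists>a. 0 < a \<and> a < t \<and> \<phi> t - \<phi> 0 = (t - 0) *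
      (frechet_derivative f (at (x + t *\<^sub>R v + a *\<^sub>R u)) u - frechet_derivative f (at (x + a *\<^sub>R u)) u)"
    unfolding \<phi>_def
    by (intro MVT2 derivative_intros line C1 \<open>t > 0\<close>)
      (use inball[of _ t] inball[of _ 0] t in \<open>auto simp: algebra_simps\<close>)
  then obtain a where a: "0 < a" "a < t" and eq1: "\<phi> t - \<phi> 0 = t *
      (frechet_derivative f (at (x + t *\<^sub>R v + a *\<^sub>R u)) u - frechet_derivative f (at (x + a *\<^sub>R u)) u)"
    by auto
  have "\<exists>b. 0 < b \<and> b < t \<and>
     frechet_derivative f (at (x + a *\<^sub>R u + t *\<^sub>R v)) u - frechet_derivative f (at (x + a *\<^sub>R u + 0 *\<^sub>R v)) u
     = (t - 0) * frechet_derivative (\<lambda>z. frechet_derivative f (at z) u) (at (x + a *\<^sub>R u + b *\<^sub>R v)) v"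
    by (intro MVT2[where f = "\<lambda>s. frechet_derivative f (at (x + a *\<^sub>R u + s *\<^sub>R v)) u"] line C2 \<open>t > 0\<close>)
      (use inball a in auto)
  then obtain b where b: "0 < b" "b < t" and eq2:
     "frechet_derivative f (at (x + a *\<^sub>R u + t *\<^sub>R v)) u - frechet_derivative f (at (x + a *\<^sub>R u)) u
     = t * frechet_derivative (\<lambda>z. frechet_derivative f (at z) u) (at (x + a *\<^sub>R u + b *\<^sub>R v)) v"
    by auto
  show ?thesis
    using inb[of a b] a b eq1 eq2 unfolding \<phi>_def
    by (intro exI[of _ "x + a *\<^sub>R u + b *\<^sub>R v"]) (auto simp: algebra_simps)
qed

text \<open>The mixed second difference is symmetric in \<open>u\<close> and \<open>v\<close>;
  divided by the square of the step it converges to each of the two iterated derivatives.\<close>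

lemma C_2_symmetric:
  fixes f :: "'a::euclidean_space \<Rightarrow> real"
  assumes "open S" "x \<in> S" "C_on 2 S f"
  shows "frechet_derivative (\<lambda>z. frechet_derivative f (at z) u) (at x) v
    = frechet_derivative (\<lambda>z. frechet_derivative f (at z) v) (at x) u"
proof -
  obtain e where e: "e > 0" "ball x e \<subseteq> S" using assms openE by blast
  have C: "C_on 2 (ball x e) f" using assms(3) e(2) C_on_subset by blast
  \<comment> \<open>The summand 1 keeps \<open>K\<close> positive when both vectors vanish and makes
    the bound \<open>tK\<close> strict already for \<open>n = 0\<close>.\<close>
  define K where "K = norm u + norm v + 1"
  have K: "K > 0" "norm u + norm v < K" unfolding K_def by (auto simp: add_nonneg_pos)
  define t where "t n = e / K / (real n + 1)" for n :: nat
  have t0: "t n > 0" for n using e K by (simp add: t_def)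
  have tK: "t n * (norm u + norm v) < e" for n
  proof -
    have "t n * (norm u + norm v) < t n * K" using K t0 by simp
    also have "\<dots> = e / (real n + 1)" using K by (simp add: t_def)
    also have "\<dots> \<le> e" using e by (simp add: divide_le_eq)
    finally show ?thesis .
  qed
  have tlim: "(\<lambda>n. t n * c) \<longlonglongrightarrow> 0" for c
  proof -
    have "(\<lambda>n. 1 / (real n + 1)) \<longlonglongrightarrow> 0" using LIMSEQ_inverse_real_of_nat by (simp add: inverse_eq_divide add.commute)
    from tendsto_mult_right[OF this, of "e / K * c"] show ?thesis by (simp add: t_def mult.commute)
  qed
  let ?F = "\<lambda>u v y. frechet_derivative (\<lambda>z. frechet_derivative f (at z) u) (at y) v"
  have lim: "(\<lambda>n. (f (x + t n *\<^sub>R u + t n *\<^sub>R v) - f (x + t n *\<^sub>R u) - f (x + t n *\<^sub>R v) + f x)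
      / (t n * t n)) \<longlonglongrightarrow> ?F u v x"
    if uv: "norm u + norm v < K" "\<And>n. t n * (norm u + norm v) < e" for u v
  proof -
    have "\<forall>n. \<exists>y. dist y x \<le> t n * (norm u + norm v) \<and>
        f (x + t n *\<^sub>R u + t n *\<^sub>R v) - f (x + t n *\<^sub>R u) - f (x + t n *\<^sub>R v) + f x
        = t n * t n * ?F u v y"
      by (intro allI C_2_mixed_difference[OF C t0 uv(2)])
    from choice[OF this] obtain y where y: "\<And>n. dist (y n) x \<le> t n * (norm u + norm v)"
      "\<And>n. f (x + t n *\<^sub>R u + t n *\<^sub>R v) - f (x + t n *\<^sub>R u) - f (x + t n *\<^sub>R v) + f x
        = t n * t n * ?F u v (y n)"
      by auto
    have "y \<longlonglongrightarrow> x"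
      by (rule iffD2[OF tendsto_dist_iff], rule tendsto_sandwich[OF _ _ tendsto_const tlim[of "norm u + norm v"]])
        (simp_all add: y(1))
    moreover have "isCont (?F u v) x"
    proof -
      have "continuous_on (ball x e) (?F u v)" using C by (simp add: numeral_2_eq_2)
      then show ?thesis using e by (simp add: continuous_on_eq_continuous_at)
    qed
    ultimately have "(\<lambda>n. ?F u v (y n)) \<longlonglongrightarrow> ?F u v x" by (rule isCont_tendsto_compose[rotated])
    moreover have "t n \<noteq> 0" for n using t0[of n] by simp
    ultimately show ?thesis by (simp add: y(2))
  qed
  \<comment> \<open>These equations turn the quotients for the pair \<open>v, u\<close> into those
    for \<open>u, v\<close>, so that both limits belong to one sequence.\<close>
  have sw: "x + a *\<^sub>R v + a *\<^sub>R u = x + a *\<^sub>R u + a *\<^sub>R v" "p - f (x + a *\<^sub>R v) - f (x + a *\<^sub>R u) = p - f (x + a *\<^sub>R u) - f (x + a *\<^sub>R v)"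
    for a p by simp_all
  have uv: "norm v + norm u = norm u + norm v" by simp
  show ?thesis
    by (rule LIMSEQ_unique[OF lim[OF K(2) tK] lim[of v u, unfolded sw uv, OF K(2) tK]])
qed

section \<open>Transfer from finite order to smooth maps\<close>

lemma smooth_on_cong:
  "open S \<Longrightarrow> (\<And>x. x \<in> S \<Longrightarrow> f x = g x) \<Longrightarrow> smooth_on S f \<longleftrightarrow> smooth_on S g"
  unfolding smooth_on_def using C_on_cong by blast

lemma smooth_on_subset: "smooth_on S f \<Longrightarrow> T \<subseteq> S \<Longrightarrow> smooth_on T f"
  unfolding smooth_on_def using C_on_subset by blast

lemma smooth_on_compose:
  fixes g :: "'a::euclidean_space \<Rightarrow> 'b::euclidean_space"
  assumes "open S" "open T" "smooth_on T f" "smooth_on S g" "g ` S \<subseteq> T"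
  shows "smooth_on S (f \<circ> g)"
  using assms C_on_compose unfolding smooth_on_def by blast

lemma smooth_on_imp_continuous_on: "smooth_on S f \<Longrightarrow> continuous_on S f"
  unfolding smooth_on_def using C_on.simps(1) by blast

lemma smooth_on_has_derivative:
  "smooth_on S f \<Longrightarrow> x \<in> S \<Longrightarrow> (f has_derivative frechet_derivative f (at x)) (at x)"
  unfolding smooth_on_def using C_on_Suc_has_derivative by blast

lemma smooth_on_bounded_linear: "bounded_linear f \<Longrightarrow> smooth_on S f"
  unfolding smooth_on_def using C_on_bounded_linear by blast

lemma smooth_on_bilinear:
  "bounded_bilinear b \<Longrightarrow> open S \<Longrightarrow> smooth_on S f \<Longrightarrow> smooth_on S g \<Longrightarrow> smooth_on S (\<lambda>x. b (f x) (g x))"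
  unfolding smooth_on_def using C_on_bilinear by blast

lemma smooth_on_const: "smooth_on S (\<lambda>x. c)"
  unfolding smooth_on_def using C_on_const by blast

lemma smooth_on_sum:
  "open S \<Longrightarrow> (\<And>i. i \<in> I \<Longrightarrow> smooth_on S (f i)) \<Longrightarrow> smooth_on S (\<lambda>x. \<Sum>i\<in>I. f i x)"
  unfolding smooth_on_def by (intro allI C_on_sum) auto

lemma smooth_on_locally:
  assumes "open S" "\<And>x. x \<in> S \<Longrightarrow> \<exists>T. open T \<and> x \<in> T \<and> smooth_on T f"
  shows "smooth_on S f"
  unfolding smooth_on_def
proof
  fix k show "C_on k S f"
    by (rule C_on_locally[OF assms(1)]) (use assms(2) smooth_on_def in blast)
qed

lemma smooth_on_symmetric:
  fixes f :: "'a::euclidean_space \<Rightarrow> real"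
  assumes "open S" "x \<in> S" "smooth_on S f"
  shows "frechet_derivative (\<lambda>z. frechet_derivative f (at z) u) (at x) v
    = frechet_derivative (\<lambda>z. frechet_derivative f (at z) v) (at x) u"
  by (rule C_2_symmetric[OF assms(1,2)]) (use assms(3) smooth_on_def in blast)

lemma smooth_on_frechet_derivative:
  "smooth_on S f \<Longrightarrow> smooth_on S (\<lambda>x. frechet_derivative f (at x) v)"
  unfolding smooth_on_def using C_on.simps(2) by blast

text \<open>A product rule: the pairing depends on \<open>z\<close> through the derivative of
  \<open>g\<close> and through the direction \<open>V z\<close>. Expansion over \<open>Basis\<close>
  reduces it to derivatives in fixed directions. In a commutator of two fields the first term
  cancels by symmetry and the second one survives.\<close>

lemma has_derivative_frechet_derivative_along:
  fixes g :: "'a::euclidean_space \<Rightarrow> real"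
  assumes S: "open S" "x \<in> S" and g: "smooth_on S g" and V: "(V has_derivative V') (at x)"
  shows "((\<lambda>z. frechet_derivative g (at z) (V z)) has_derivative
    (\<lambda>h. frechet_derivative (\<lambda>z. frechet_derivative g (at z) (V x)) (at x) h
      + frechet_derivative g (at x) (V' h))) (at x)"
proof -
  let ?D = "\<lambda>v z. frechet_derivative g (at z) v"
  have expand: "?D v z = (\<Sum>b\<in>Basis. (v \<bullet> b) * ?D b z)" if "z \<in> S" for v z
  proof -
    have lin: "linear (frechet_derivative g (at z))"
      using smooth_on_has_derivative[OF g that] has_derivative_linear by blast
    show ?thesis using linear_Basis_expansion[OF lin, of v] by simp
  qed
  have D2: "(?D v has_derivative frechet_derivative (?D v) (at x)) (at x)" for v
    by (rule smooth_on_has_derivative[OF smooth_on_frechet_derivative[OF g] S(2)])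
  have E: "((\<lambda>z. \<Sum>b\<in>Basis. (v \<bullet> b) * ?D b z) has_derivative
      (\<lambda>h. \<Sum>b\<in>Basis. (v \<bullet> b) * frechet_derivative (?D b) (at x) h)) (at x)" for v
    by (intro has_derivative_sum has_derivative_mult_right D2)
  have D2_expand: "frechet_derivative (?D v) (at x)
      = (\<lambda>h. \<Sum>b\<in>Basis. (v \<bullet> b) * frechet_derivative (?D b) (at x) h)" for v
    by (rule frechet_derivative_eq[OF has_derivative_transform_within_open[OF E S]])
      (simp add: expand[symmetric])
  have "((\<lambda>z. \<Sum>b\<in>Basis. (V z \<bullet> b) * ?D b z) has_derivative
      (\<lambda>h. \<Sum>b\<in>Basis. (V x \<bullet> b) * frechet_derivative (?D b) (at x) h + (V' h \<bullet> b) * ?D b x)) (at x)"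
    by (intro has_derivative_sum has_derivative_mult has_derivative_inner_left V D2)
  moreover have "(\<Sum>b\<in>Basis. (V x \<bullet> b) * frechet_derivative (?D b) (at x) h + (V' h \<bullet> b) * ?D b x)
      = frechet_derivative (?D (V x)) (at x) h + ?D (V' h) x" for h
    unfolding sum.distrib
    by (rule arg_cong2[where f = "(+)", OF fun_cong[OF D2_expand, symmetric] expand[OF S(2), symmetric]])
  ultimately have "((\<lambda>z. \<Sum>b\<in>Basis. (V z \<bullet> b) * ?D b z) has_derivative
      (\<lambda>h. frechet_derivative (?D (V x)) (at x) h + ?D (V' h) x)) (at x)"
    by simp
  from has_derivative_transform_within_open[OF this S] show ?thesis
    by (simp add: expand[symmetric])
qed

section \<open>Frames and their brackets\<close>

text \<open>The target is a mere real vector space because tangent vectors are operators on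
  functions; hence the interpreted locale asks for a finite basis of the domain only.\<close>

lemma dim_linear_inj_image:
  fixes L :: "'a::euclidean_space \<Rightarrow> 'b::real_vector"
  assumes "linear L" "inj L"
  shows "dim (L ` S) = dim S"
proof -
  interpret finite_dimensional_vector_space_pair_1 "scaleR :: real \<Rightarrow> 'a \<Rightarrow> 'a" Basis
    "scaleR :: real \<Rightarrow> 'b \<Rightarrow> 'b"
    by unfold_locales
  show ?thesis
    using dim_image_eq[of L S] assms inj_on_subset[OF assms(2), of "span S"]
    by (simp add: linear_def dim_raw_def span_raw_def)
qed

text \<open>If the Gram determinant vanished, \<open>w\<close> below would be orthogonal to both
  \<open>a\<close> and \<open>b\<close>, hence to itself, and \<open>w = 0\<close> would be a linear
  relation that forces \<open>b = 0\<close>.\<close>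

lemma gram_det_nonzero:
  fixes a b :: "'a::real_inner"
  assumes "\<And>s t. s *\<^sub>R a + t *\<^sub>R b = 0 \<Longrightarrow> s = 0 \<and> t = 0"
  shows "(a \<bullet> a) * (b \<bullet> b) - (a \<bullet> b) * (a \<bullet> b) \<noteq> 0"
proof
  assume eq: "(a \<bullet> a) * (b \<bullet> b) - (a \<bullet> b) * (a \<bullet> b) = 0"
  define w where "w = (b \<bullet> b) *\<^sub>R a + (- (a \<bullet> b)) *\<^sub>R b"
  have "w \<bullet> a = 0" "w \<bullet> b = 0"
    using eq by (simp_all add: w_def inner_diff_left inner_commute algebra_simps)
  then have "w \<bullet> w = 0"
    by (subst (2) w_def) (simp add: inner_diff_right)
  then have "b = 0" using assms[of "b \<bullet> b" "- (a \<bullet> b)"] by (simp add: w_def)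
  with assms[of 0 1] show False by simp
qed

text \<open>Pairing \<open>X\<close> with \<open>F\<close> and \<open>G\<close> gives a linear
  system for the coefficients whose determinant \<open>d\<close> is the Gram determinant. Cramer's
  rule writes \<open>u\<close> as \<open>n / d\<close>, a quotient of differentiable
  functions.\<close>

lemma frame_coefficient_differentiable:
  fixes X F G :: "'a::real_normed_vector \<Rightarrow> 'b::real_inner"
  assumes "open W" "x \<in> W"
    and X: "\<And>z. z \<in> W \<Longrightarrow> X z = u z *\<^sub>R F z + v z *\<^sub>R G z"
    and indep: "\<And>z s t. z \<in> W \<Longrightarrow> s *\<^sub>R F z + t *\<^sub>R G z = 0 \<Longrightarrow> s = 0 \<and> t = 0"
    and diff: "X differentiable at x" "F differentiable at x" "G differentiable at x"
  shows "u differentiable at x"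
proof -
  define d where "d z = (F z \<bullet> F z) * (G z \<bullet> G z) - (F z \<bullet> G z) * (F z \<bullet> G z)" for z
  define n where "n z = (X z \<bullet> F z) * (G z \<bullet> G z) - (X z \<bullet> G z) * (F z \<bullet> G z)" for z
  have d: "d z \<noteq> 0" if "z \<in> W" for z
    unfolding d_def by (rule gram_det_nonzero) (rule indep[OF that])
  have u: "n z / d z = u z" if "z \<in> W" for z
  proof -
    have "n z = u z * d z"
      unfolding n_def d_def X[OF that] by (simp add: inner_add_left inner_commute algebra_simps)
    then show ?thesis using d[OF that] by simp
  qed
  have "n differentiable at x" "d differentiable at x"
    unfolding n_def d_def using diff by (auto intro!: differentiable_diff differentiable_mult differentiable_inner)
  then have "(\<lambda>z. n z / d z) differentiable at x"
    using d \<open>x \<in> W\<close> by (intro differentiable_divide) auto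
  then obtain D where "((\<lambda>z. n z / d z) has_derivative D) (at x)"
    unfolding differentiable_def by blast
  from has_derivative_transform_within_open[OF this \<open>open W\<close> \<open>x \<in> W\<close>, of u] u show ?thesis
    unfolding differentiable_def by blast
qed

text \<open>The derivatives of the coefficients only contribute multiples of \<open>F1\<close> and \<open>F2\<close>.\<close>

lemma frame_bracket:
  fixes F0 F1 F2 X Y :: "'a::real_inner \<Rightarrow> 'a"
  assumes W: "open W" "x \<in> W"
    and X: "\<And>z. z \<in> W \<Longrightarrow> X z = c *\<^sub>R F0 z + u1 z *\<^sub>R F1 z + u2 z *\<^sub>R F2 z"
    and Y: "\<And>z. z \<in> W \<Longrightarrow> Y z = v1 z *\<^sub>R F1 z + v2 z *\<^sub>R F2 z"
    and indep: "\<And>z s t. z \<in> W \<Longrightarrow> s *\<^sub>R F1 z + t *\<^sub>R F2 z = 0 \<Longrightarrow> s = 0 \<and> t = 0"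
    and D: "(X has_derivative GX) (at x)" "(Y has_derivative GY) (at x)" "(F0 has_derivative G0) (at x)"
      "(F1 has_derivative G1) (at x)" "(F2 has_derivative G2) (at x)"
  shows "GY (X x) - GX (Y x) - ((u1 x * v2 x - u2 x * v1 x) *\<^sub>R (G2 (F1 x) - G1 (F2 x))
      + (c * v1 x) *\<^sub>R (G1 (F0 x) - G0 (F1 x)) + (c * v2 x) *\<^sub>R (G2 (F0 x) - G0 (F2 x)))
    \<in> span {F1 x, F2 x}"
proof -
  have diffs: "X differentiable at x" "Y differentiable at x" "F0 differentiable at x"
    "F1 differentiable at x" "F2 differentiable at x"
    using D differentiable_def by blast+
  \<comment> \<open>Removing the constant multiple of \<open>F0\<close> leaves a field in the plane
    of \<open>F1\<close> and \<open>F2\<close>, to which the lemma on coefficients applies.\<close>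
  have X': "(\<lambda>z. X z - c *\<^sub>R F0 z) differentiable at x"
    using diffs by (auto intro!: differentiable_diff differentiable_scaleR)
  \<comment> \<open>The lemma on coefficients speaks of the first coefficient; exchanging the two
    frame vectors gives the second.\<close>
  have swap: "t *\<^sub>R F2 z + s *\<^sub>R F1 z = 0 \<Longrightarrow> t = 0 \<and> s = 0" if "z \<in> W" for z s t
    using indep[OF that, of s t] by (simp add: add.commute)
  have "u1 differentiable at x"
    by (rule frame_coefficient_differentiable[OF W _ indep X' diffs(4,5)]) (auto simp: X)
  moreover have "u2 differentiable at x"
    by (rule frame_coefficient_differentiable[OF W _ swap X' diffs(5,4)]) (auto simp: X)
  moreover have "v1 differentiable at x"
    by (rule frame_coefficient_differentiable[OF W _ indep diffs(2,4,5)]) (auto simp: Y)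
  moreover have "v2 differentiable at x"
    by (rule frame_coefficient_differentiable[OF W _ swap diffs(2,5,4)]) (auto simp: Y)
  ultimately obtain U1 U2 V1 V2 where UV: "(u1 has_derivative U1) (at x)" "(u2 has_derivative U2) (at x)"
    "(v1 has_derivative V1) (at x)" "(v2 has_derivative V2) (at x)"
    unfolding differentiable_def by blast
  have "((\<lambda>z. c *\<^sub>R F0 z + u1 z *\<^sub>R F1 z + u2 z *\<^sub>R F2 z) has_derivative
      (\<lambda>h. c *\<^sub>R G0 h + (u1 x *\<^sub>R G1 h + U1 h *\<^sub>R F1 x) + (u2 x *\<^sub>R G2 h + U2 h *\<^sub>R F2 x))) (at x)"
    by (intro has_derivative_add has_derivative_scaleR_right has_derivative_scaleR D UV)
  from has_derivative_transform_within_open[OF this W X[symmetric]]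
  have GX: "GX = (\<lambda>h. c *\<^sub>R G0 h + (u1 x *\<^sub>R G1 h + U1 h *\<^sub>R F1 x) + (u2 x *\<^sub>R G2 h + U2 h *\<^sub>R F2 x))"
    using D(1) has_derivative_unique by blast
  have "((\<lambda>z. v1 z *\<^sub>R F1 z + v2 z *\<^sub>R F2 z) has_derivative
      (\<lambda>h. (v1 x *\<^sub>R G1 h + V1 h *\<^sub>R F1 x) + (v2 x *\<^sub>R G2 h + V2 h *\<^sub>R F2 x))) (at x)"
    by (intro has_derivative_add has_derivative_scaleR D UV)
  from has_derivative_transform_within_open[OF this W Y[symmetric]]
  have GY: "GY = (\<lambda>h. (v1 x *\<^sub>R G1 h + V1 h *\<^sub>R F1 x) + (v2 x *\<^sub>R G2 h + V2 h *\<^sub>R F2 x))"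
    using D(2) has_derivative_unique by blast
  have lin: "linear G0" "linear G1" "linear G2"
    using D has_derivative_linear by blast+
  have "GY (X x) - GX (Y x) - ((u1 x * v2 x - u2 x * v1 x) *\<^sub>R (G2 (F1 x) - G1 (F2 x))
      + (c * v1 x) *\<^sub>R (G1 (F0 x) - G0 (F1 x)) + (c * v2 x) *\<^sub>R (G2 (F0 x) - G0 (F2 x)))
    = (V1 (X x) - U1 (Y x)) *\<^sub>R F1 x + (V2 (X x) - U2 (Y x)) *\<^sub>R F2 x"
    unfolding GX GY unfolding X[OF W(2)] Y[OF W(2)]
    by (simp add: lin[THEN linear_add] lin[THEN linear_scale] algebra_simps)
  then show ?thesis by (simp only:) (intro span_add span_scale span_base; simp)
qed

section \<open>Affine lines and annihilating covectors\<close>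

lemma affine_line_linear_image:
  assumes "linear L" "inj L" "affine_line S"
  shows "affine_line (L ` S)"
proof -
  obtain a d where "d \<noteq> 0" "S = {a + t *\<^sub>R d | t. True}"
    using assms(3) by (auto simp: affine_line_def)
  then show ?thesis
    unfolding affine_line_def
    using assms(1,2) linear_injective_0[OF assms(1)]
    by (intro exI[of _ "L a"] exI[of _ "L d"]) (auto simp: image_iff linear_add linear_scale, force simp: linear_add linear_scale)
qed

text \<open>Four vectors of dimension 4 are independent, so a linear functional may take any values
  on them; \<open>\<xi>\<close> is the vector that represents this functional.\<close>

lemma prescribed_inner_products:
  fixes a b w g :: "'e::euclidean_space"
  assumes "dim {a, b, w, g} = 4"
  shows "\<exists>\<xi>. \<xi> \<bullet> a = 0 \<and> \<xi> \<bullet> b = 0 \<and> \<xi> \<bullet> w = r \<and> \<xi> \<bullet> g = s"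
proof -
  \<comment> \<open>Since \<open>dim\<close> is at most \<open>card\<close>, dimension 4 excludes
    coincidences among the four vectors.\<close>
  have card: "card {a, b, w, g} = 4"
    using dim_le_card'[of "{a, b, w, g}"] assms card_insert_le_m1[of 4 "{b,w,g}" a]
      card_insert_le_m1[of 3 "{w,g}" b] card_insert_le_m1[of 2 "{g}" w] by simp
  then have dist: "distinct [a, b, w, g]"
    using card_distinct[of "[a,b,w,g]"] by simp
  have "independent {a, b, w, g}"
    by (rule card_le_dim_spanning[of _ "{a, b, w, g}"]) (use assms card in \<open>auto intro: span_base\<close>)
  from linear_independent_extend[OF this, of "\<lambda>x. if x = w then r else if x = g then s else 0"]
  obtain h :: "'e \<Rightarrow> real" where h: "linear h" "h a = 0" "h b = 0" "h w = r" "h g = s"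
    using dist by auto
  have "(\<Sum>i\<in>Basis. h i *\<^sub>R i) \<bullet> x = h x" for x
    unfolding linear_Basis_expansion[OF h(1), of x] inner_sum_left inner_scaleR_left
    by (simp add: inner_commute mult.commute)
  then show ?thesis using h by (intro exI[of _ "\<Sum>i\<in>Basis. h i *\<^sub>R i"]) simp
qed

text \<open>The coordinate form of the claim at a single point: \<open>a0\<close>,
  \<open>a1\<close>, \<open>a2\<close> are values of the three fields. The signs in
  \<open>- w\<close> and \<open>- g1\<close> are those of \<open>[f2, f1]\<close> and
  \<open>[f1, f0]\<close> in the extremal field.\<close>

lemma affine_line_of_annihilator:
  fixes a0 a1 a2 w g1 g2 :: "'e::euclidean_space"
  assumes dim3: "dim {a1, a2, w} = 3" and dim4: "dim {a1, a2, w, g1, g2} = 4"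
    and indep: "\<And>s t. s *\<^sub>R a1 + t *\<^sub>R a2 = 0 \<Longrightarrow> s = 0 \<and> t = 0"
  shows "affine_line {a0 + (\<xi> \<bullet> g2 / (\<xi> \<bullet> - w)) *\<^sub>R a1 + (\<xi> \<bullet> - g1 / (\<xi> \<bullet> - w)) *\<^sub>R a2 | \<xi>.
    \<xi> \<bullet> a1 = 0 \<and> \<xi> \<bullet> a2 = 0 \<and> \<xi> \<bullet> w \<noteq> 0}"
proof -
  obtain g where g: "g \<in> {g1, g2}" "g \<notin> span {a1, a2, w}"
  proof -
    have "\<not> {g1, g2} \<subseteq> span {a1, a2, w}"
    proof
      assume "{g1, g2} \<subseteq> span {a1, a2, w}"
      then have "{a1, a2, w, g1, g2} \<subseteq> span {a1, a2, w}" by (auto intro: span_base)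
      from dim_mono[OF this] show False using dim3 dim4 by simp
    qed
    then show ?thesis using that by blast
  qed
  have "dim (insert g {a1, a2, w}) = 4" using g(2) dim3 by (simp add: dim_insert)
  moreover have "insert g {a1, a2, w} = {a1, a2, w, g}" by auto
  ultimately have dimg: "dim {a1, a2, w, g} = 4" by simp
  have "span {a1, a2, w, g} = span {a1, a2, w, g1, g2}"
    by (rule dim_eq_span) (use g(1) dim4 dimg in auto)
  then have mem: "g1 \<in> span {a1, a2, w, g}" "g2 \<in> span {a1, a2, w, g}" by (auto intro: span_base)
  have expand: "\<exists>\<alpha> \<beta>. \<forall>\<xi>. \<xi> \<bullet> a1 = 0 \<longrightarrow> \<xi> \<bullet> a2 = 0 \<longrightarrow> \<xi> \<bullet> x = \<alpha> * (\<xi> \<bullet> w) + \<beta> * (\<xi> \<bullet> g)"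
    if x: "x \<in> span {a1, a2, w, g}" for x
  proof -
    obtain k1 where "x - k1 *\<^sub>R a1 \<in> span {a2, w, g}" using x span_breakdown_eq by blast
    then obtain k2 where "x - k1 *\<^sub>R a1 - k2 *\<^sub>R a2 \<in> span {w, g}" using span_breakdown_eq by blast
    then obtain k3 where "x - k1 *\<^sub>R a1 - k2 *\<^sub>R a2 - k3 *\<^sub>R w \<in> span {g}" using span_breakdown_eq by blast
    then obtain k4 where k4: "x - k1 *\<^sub>R a1 - k2 *\<^sub>R a2 - k3 *\<^sub>R w = k4 *\<^sub>R g" by (auto simp: span_singleton)
    then have x_eq: "x = k1 *\<^sub>R a1 + k2 *\<^sub>R a2 + k3 *\<^sub>R w + k4 *\<^sub>R g" by (simp add: algebra_simps)
    show ?thesis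
      by (rule exI[of _ k3], rule exI[of _ k4]) (simp add: x_eq inner_add_right)
  qed
  obtain \<alpha>1 \<beta>1 \<alpha>2 \<beta>2 where
    e1: "\<And>\<xi>. \<xi> \<bullet> a1 = 0 \<Longrightarrow> \<xi> \<bullet> a2 = 0 \<Longrightarrow> \<xi> \<bullet> g1 = \<alpha>1 * (\<xi> \<bullet> w) + \<beta>1 * (\<xi> \<bullet> g)" and
    e2: "\<And>\<xi>. \<xi> \<bullet> a1 = 0 \<Longrightarrow> \<xi> \<bullet> a2 = 0 \<Longrightarrow> \<xi> \<bullet> g2 = \<alpha>2 * (\<xi> \<bullet> w) + \<beta>2 * (\<xi> \<bullet> g)"
    using expand[OF mem(1)] expand[OF mem(2)] by blast
  \<comment> \<open>Otherwise a covector with value 0 on \<open>a1\<close>, \<open>a2\<close>,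
    \<open>w\<close> and 1 on \<open>g\<close> would vanish on both \<open>g1\<close> and
    \<open>g2\<close>, one of which is \<open>g\<close>.\<close>
  have \<beta>: "\<not> (\<beta>1 = 0 \<and> \<beta>2 = 0)"
  proof
    assume "\<beta>1 = 0 \<and> \<beta>2 = 0"
    moreover obtain \<xi> where "\<xi> \<bullet> a1 = 0" "\<xi> \<bullet> a2 = 0" "\<xi> \<bullet> w = 0" "\<xi> \<bullet> g = 1"
      using prescribed_inner_products[OF dimg, of 0 1] by blast
    ultimately show False using e1[of \<xi>] e2[of \<xi>] g(1) by auto
  qed
  \<comment> \<open>After \<open>e1\<close> and \<open>e2\<close> are inserted, \<open>a\<close>
    collects what is independent of the ratio of \<open>\<xi> \<bullet> g\<close> to
    \<open>\<xi> \<bullet> w\<close>, and \<open>d\<close> is the coefficient of this ratio.\<close>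
  define a where "a = a0 - \<alpha>2 *\<^sub>R a1 + \<alpha>1 *\<^sub>R a2"
  define d where "d = (- \<beta>2) *\<^sub>R a1 + \<beta>1 *\<^sub>R a2"
  have "d \<noteq> 0" using indep[of "- \<beta>2" \<beta>1] \<beta> by (auto simp: d_def)
  have pt: "a0 + (\<xi> \<bullet> g2 / (\<xi> \<bullet> - w)) *\<^sub>R a1 + (\<xi> \<bullet> - g1 / (\<xi> \<bullet> - w)) *\<^sub>R a2
      = a + (\<xi> \<bullet> g / (\<xi> \<bullet> w)) *\<^sub>R d"
    if "\<xi> \<bullet> a1 = 0" "\<xi> \<bullet> a2 = 0" "\<xi> \<bullet> w \<noteq> 0" for \<xi>
  proof -
    have "\<xi> \<bullet> g2 / (\<xi> \<bullet> - w) = - \<alpha>2 - \<beta>2 * (\<xi> \<bullet> g / (\<xi> \<bullet> w))"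
      "\<xi> \<bullet> - g1 / (\<xi> \<bullet> - w) = \<alpha>1 + \<beta>1 * (\<xi> \<bullet> g / (\<xi> \<bullet> w))"
      using that by (simp_all add: e1 e2 field_simps)
    then show ?thesis unfolding a_def d_def by (simp only:) (simp add: algebra_simps)
  qed
  have "{a0 + (\<xi> \<bullet> g2 / (\<xi> \<bullet> - w)) *\<^sub>R a1 + (\<xi> \<bullet> - g1 / (\<xi> \<bullet> - w)) *\<^sub>R a2 | \<xi>.
    \<xi> \<bullet> a1 = 0 \<and> \<xi> \<bullet> a2 = 0 \<and> \<xi> \<bullet> w \<noteq> 0} = {a + t *\<^sub>R d | t. True}" (is "?S = ?T")
  proof
    show "?S \<subseteq> ?T" using pt by blast
    show "?T \<subseteq> ?S"
    proof
      fix y assume "y \<in> ?T"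
      then obtain t where y: "y = a + t *\<^sub>R d" by blast
      \<comment> \<open>Normalising the value on \<open>w\<close> to 1 makes the ratio equal to
        \<open>t\<close>.\<close>
      obtain \<xi> where \<xi>: "\<xi> \<bullet> a1 = 0" "\<xi> \<bullet> a2 = 0" "\<xi> \<bullet> w = 1" "\<xi> \<bullet> g = t"
        using prescribed_inner_products[OF dimg, of 1 t] by blast
      with pt[of \<xi>] y show "y \<in> ?S" by (auto intro!: exI[of _ \<xi>])
    qed
  qed
  then show ?thesis using \<open>d \<noteq> 0\<close> by (auto simp: affine_line_def)
qed

section \<open>Tangent vectors and Lie brackets in a chart\<close>

text \<open>Isolates the facts about charts on which all local computations rest; the topology of
  \<open>M\<close> enters through the openness of the overlap images.\<close>

locale smooth_atlas =
  fixes A :: "('m, 'e::euclidean_space) chart set"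
  assumes inj_on_chart: "c \<in> A \<Longrightarrow> inj_on (snd c) (fst c)"
    and open_overlap: "c \<in> A \<Longrightarrow> d \<in> A \<Longrightarrow> open (snd c ` (fst c \<inter> fst d))"
    and smooth_transition:
      "c \<in> A \<Longrightarrow> d \<in> A \<Longrightarrow> smooth_on (snd c ` (fst c \<inter> fst d)) (snd d \<circ> chart_inv c)"

lemma smooth_manifold_imp_smooth_atlas:
  assumes "smooth_manifold M A"
  shows "smooth_atlas A"
proof
  fix c d assume c: "c \<in> A" and d: "d \<in> A"
  have U: "openin M (fst c)" "openin M (fst d)" "open (snd c ` fst c)"
    and h: "homeomorphic_map (subtopology M (fst c)) (top_of_set (snd c ` fst c)) (snd c)"
    and s: "smooth_on (snd c ` (fst c \<inter> fst d)) (snd d \<circ> chart_inv c)"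
    using assms c d unfolding smooth_manifold_def by (auto simp: split_beta)
  show "smooth_on (snd c ` (fst c \<inter> fst d)) (snd d \<circ> chart_inv c)" by (rule s)
  have "topspace (subtopology M (fst c)) = fst c" using openin_subset[OF U(1)] by auto
  then show "inj_on (snd c) (fst c)" using homeomorphic_imp_injective_map[OF h] by simp
  have "openin (subtopology M (fst c)) (fst c \<inter> fst d)"
    using U(2) by (auto simp: openin_subtopology)
  then have "openin (top_of_set (snd c ` fst c)) (snd c ` (fst c \<inter> fst d))"
    using homeomorphic_imp_open_map[OF h] by (auto simp: open_map_def)
  then show "open (snd c ` (fst c \<inter> fst d))"
    using U(3) openin_open_trans by blast
qed

locale chart_in_atlas = smooth_atlas +
  fixes c assumes chart_mem: "c \<in> A"
begin

abbreviation "U \<equiv> fst c"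
abbreviation "\<phi> \<equiv> snd c"
abbreviation "\<psi> \<equiv> chart_inv c"

lemma chart_inv_chart [simp]: "m \<in> U \<Longrightarrow> \<psi> (\<phi> m) = m"
  unfolding chart_inv_def using inj_on_chart[OF chart_mem] by simp

lemma chart_chart_inv [simp]: "x \<in> \<phi> ` U \<Longrightarrow> \<phi> (\<psi> x) = x"
  by auto

lemma chart_inv_mem [simp]: "x \<in> \<phi> ` U \<Longrightarrow> \<psi> x \<in> U"
  by auto

lemma open_chart_image: "open (\<phi> ` U)"
  using open_overlap[OF chart_mem chart_mem] by simp

text \<open>The definition of \<open>smooth_at\<close> allows any chart as witness. Composition with
  a smooth transition map moves the witness into the fixed chart \<open>c\<close>.\<close>

lemma smooth_at_iff:
  assumes "q \<in> U"
  shows "smooth_at A q f \<longleftrightarrow> (\<exists>W. open W \<and> \<phi> q \<in> W \<and> W \<subseteq> \<phi> ` U \<and> smooth_on W (f \<circ> \<psi>))"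
proof
  assume "smooth_at A q f"
  then obtain d W where d: "d \<in> A" "q \<in> fst d" and W: "open W" "snd d q \<in> W"
    "W \<subseteq> snd d ` fst d" "smooth_on W (f \<circ> chart_inv d)"
    unfolding smooth_at_def by blast
  interpret d: chart_in_atlas A d by unfold_locales (rule d)
  define T where "T = \<phi> ` (U \<inter> fst d)"
  define \<tau> where "\<tau> = snd d \<circ> \<psi>"
  have T: "open T" unfolding T_def by (rule open_overlap[OF chart_mem d(1)])
  have \<tau>: "smooth_on T \<tau>" unfolding T_def \<tau>_def by (rule smooth_transition[OF chart_mem d(1)])
  define W' where "W' = T \<inter> \<tau> -` W"
  have W': "open W'"
    unfolding W'_def by (rule continuous_open_preimage[OF smooth_on_imp_continuous_on[OF \<tau>] T W(1)])
  have "smooth_on W' ((f \<circ> chart_inv d) \<circ> \<tau>)"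
    by (rule smooth_on_compose[OF W' W(1,4) smooth_on_subset[OF \<tau>]]) (auto simp: W'_def)
  moreover have "((f \<circ> chart_inv d) \<circ> \<tau>) x = (f \<circ> \<psi>) x" if "x \<in> W'" for x
    using that by (auto simp: W'_def T_def \<tau>_def)
  ultimately have "smooth_on W' (f \<circ> \<psi>)" using smooth_on_cong[OF W'] by blast
  moreover have "\<phi> q \<in> W'" "W' \<subseteq> \<phi> ` U" using assms d W by (auto simp: W'_def T_def \<tau>_def)
  ultimately show "\<exists>W. open W \<and> \<phi> q \<in> W \<and> W \<subseteq> \<phi> ` U \<and> smooth_on W (f \<circ> \<psi>)"
    using W' by blast
next
  assume "\<exists>W. open W \<and> \<phi> q \<in> W \<and> W \<subseteq> \<phi> ` U \<and> smooth_on W (f \<circ> \<psi>)"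
  then show "smooth_at A q f" unfolding smooth_at_def using assms chart_mem by blast
qed

section \<open>Tangent vectors in coordinates\<close>

text \<open>The default 0 repeats that of \<open>velocity\<close>, so that the two can be equal as
  operators.\<close>

definition tangent_vector :: "'a \<Rightarrow> 'b \<Rightarrow> 'a tangent" where
  "tangent_vector q v =
     (\<lambda>f. if smooth_at A q f then frechet_derivative (f \<circ> \<psi>) (at (\<phi> q)) v else 0)"

lemma smooth_at_has_derivative:
  assumes "q \<in> U" "smooth_at A q f"
  shows "(f \<circ> \<psi> has_derivative frechet_derivative (f \<circ> \<psi>) (at (\<phi> q))) (at (\<phi> q))"
  using assms smooth_at_iff smooth_on_has_derivative by blast

lemma velocity_eq_tangent_vector:
  assumes q: "\<gamma> 0 = q" and S: "open S" "0 \<in> S" "\<gamma> ` S \<subseteq> U"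
    and v: "(\<phi> \<circ> \<gamma> has_vector_derivative v) (at 0)"
  shows "velocity A \<gamma> = tangent_vector q v"
proof
  fix f
  show "velocity A \<gamma> f = tangent_vector q v f"
  proof (cases "smooth_at A q f")
    case True
    have qU: "q \<in> U" using q S by auto
    let ?D = "frechet_derivative (f \<circ> \<psi>) (at (\<phi> q))"
    have D: "(f \<circ> \<psi> has_derivative ?D) (at ((\<phi> \<circ> \<gamma>) 0))"
      using smooth_at_has_derivative[OF qU True] q by simp
    have "((f \<circ> \<psi>) \<circ> (\<phi> \<circ> \<gamma>) has_derivative ?D \<circ> (\<lambda>h. h *\<^sub>R v)) (at 0)"
      by (rule diff_chain_at[OF v[unfolded has_vector_derivative_def] D])
    then have "((\<lambda>t. f (\<gamma> t)) has_derivative ?D \<circ> (\<lambda>h. h *\<^sub>R v)) (at 0)"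
      by (rule has_derivative_transform_within_open[OF _ S(1,2)]) (use S(3) in auto)
    moreover have "?D \<circ> (\<lambda>h. h *\<^sub>R v) = (*) (?D v)"
      using linear_scale[OF has_derivative_linear[OF D]] by (auto simp: mult.commute)
    ultimately have "((\<lambda>t. f (\<gamma> t)) has_real_derivative ?D v) (at 0)"
      by (simp add: has_field_derivative_def)
    then show ?thesis using True q by (simp add: velocity_def tangent_vector_def DERIV_imp_deriv)
  qed (simp add: velocity_def tangent_vector_def q)
qed

lemma line_in_chart:
  assumes "q \<in> U"
  obtains \<epsilon> where "\<epsilon> > 0" "\<And>t. \<bar>t\<bar> < \<epsilon> \<Longrightarrow> \<phi> q + t *\<^sub>R v \<in> \<phi> ` U"
proof -
  have "open ((\<lambda>t. \<phi> q + t *\<^sub>R v) -` (\<phi> ` U))"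
    by (intro open_vimage open_chart_image continuous_intros)
  moreover have "0 \<in> (\<lambda>t. \<phi> q + t *\<^sub>R v) -` (\<phi> ` U)" using assms by auto
  ultimately obtain \<epsilon> where "\<epsilon> > 0" "ball 0 \<epsilon> \<subseteq> (\<lambda>t. \<phi> q + t *\<^sub>R v) -` (\<phi> ` U)"
    using openE by blast
  then show ?thesis using that[of \<epsilon>] by (auto simp: dist_real_def subset_iff)
qed

lemma coord_vector_eq:
  assumes "q \<in> U"
  shows "coord_vector A c q v = tangent_vector q v"
proof -
  obtain \<epsilon> where \<epsilon>: "\<epsilon> > 0" "\<And>t. \<bar>t\<bar> < \<epsilon> \<Longrightarrow> \<phi> q + t *\<^sub>R v \<in> \<phi> ` U"
    using line_in_chart[OF assms] by blast
  have "((\<lambda>t. \<phi> q + t *\<^sub>R v) has_vector_derivative v) (at 0)"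
    by (auto intro!: derivative_eq_intros simp: has_vector_derivative_def)
  then have "(\<phi> \<circ> (\<lambda>t. \<psi> (\<phi> q + t *\<^sub>R v)) has_vector_derivative v) (at 0)"
    unfolding has_vector_derivative_def
    by (rule has_derivative_transform_within_open[where s = "{-\<epsilon><..<\<epsilon>}"]) (use \<epsilon> in auto)
  then show ?thesis
    unfolding coord_vector_def
    by (intro velocity_eq_tangent_vector[where S = "{-\<epsilon><..<\<epsilon>}"]) (use \<epsilon> assms in auto)
qed

lemma linear_tangent_vector:
  assumes "q \<in> U" shows "linear (tangent_vector q)"
proof -
  have "linear (frechet_derivative (f \<circ> \<psi>) (at (\<phi> q)))" if "smooth_at A q f" for f
    using smooth_at_has_derivative[OF assms that] has_derivative_linear by blast
  then show ?thesis
    by (intro linearI) (auto simp: tangent_vector_def fun_eq_iff scaleR_fun_def linear_add linear_scale)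
qed

text \<open>A left inverse of \<open>tangent_vector q\<close> for every \<open>q\<close> in the
  chart domain at once: evaluation on the coordinate functions requires no base point.\<close>

definition components :: "'a tangent \<Rightarrow> 'b" where
  "components w = (\<Sum>b\<in>Basis. w (\<lambda>m. \<phi> m \<bullet> b) *\<^sub>R b)"

lemma smooth_at_coordinate:
  assumes "q \<in> U" shows "smooth_at A q (\<lambda>m. \<phi> m \<bullet> b)"
proof -
  have "smooth_on (\<phi> ` U) (\<lambda>x. x \<bullet> b)"
    by (rule smooth_on_bounded_linear) (rule bounded_linear_inner_left)
  moreover have "((\<lambda>m. \<phi> m \<bullet> b) \<circ> \<psi>) x = x \<bullet> b" if "x \<in> \<phi> ` U" for x using that by simp
  ultimately have "smooth_on (\<phi> ` U) ((\<lambda>m. \<phi> m \<bullet> b) \<circ> \<psi>)"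
    using smooth_on_cong[OF open_chart_image] by metis
  then show ?thesis using smooth_at_iff[OF assms] open_chart_image assms by blast
qed

lemma components_tangent_vector [simp]:
  assumes "q \<in> U" shows "components (tangent_vector q v) = v"
proof -
  have D: "((\<lambda>m. \<phi> m \<bullet> b) \<circ> \<psi> has_derivative (\<lambda>x. x \<bullet> b)) (at (\<phi> q))" for b
    by (rule has_derivative_transform_within_open[OF _ open_chart_image])
      (use assms in \<open>auto intro!: derivative_eq_intros\<close>)
  then have "tangent_vector q v (\<lambda>m. \<phi> m \<bullet> b) = v \<bullet> b" for b
    using smooth_at_coordinate[OF assms] by (simp add: tangent_vector_def frechet_derivative_eq[OF D])
  then show ?thesis by (simp add: components_def euclidean_representation)
qed

lemma inj_tangent_vector: "q \<in> U \<Longrightarrow> inj (tangent_vector q)"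
  by (rule inj_on_inverseI[of _ components]) simp

text \<open>Velocities of curves thereby form a linear space. A curve may be smooth in another chart
  and has to be carried into \<open>c\<close> near time 0; conversely, straight coordinate lines
  realise every direction.\<close>

lemma tangent_space_eq:
  assumes "q \<in> U" shows "tangent_space A q = range (tangent_vector q)"
proof (intro set_eqI iffI)
  fix w assume "w \<in> tangent_space A q"
  then obtain \<gamma> d \<epsilon> where w: "w = velocity A \<gamma>" "\<gamma> 0 = q" and d: "d \<in> A" and \<epsilon>: "\<epsilon> > 0"
    and im: "\<gamma> ` {-\<epsilon><..<\<epsilon>} \<subseteq> fst d" and sm: "smooth_on {-\<epsilon><..<\<epsilon>} (snd d \<circ> \<gamma>)"
    unfolding tangent_space_def smooth_curve_def by blast
  interpret d: chart_in_atlas A d by unfold_locales (rule d)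
  define T where "T = snd d ` (fst d \<inter> U)"
  \<comment> \<open>Times at which the curve lies in both chart domains; continuity of its
    coordinate expression in \<open>d\<close> makes this set open.\<close>
  define S where "S = {-\<epsilon><..<\<epsilon>} \<inter> (snd d \<circ> \<gamma>) -` T"
  have T: "open T" unfolding T_def by (rule open_overlap[OF d chart_mem])
  have \<sigma>: "smooth_on T (\<phi> \<circ> chart_inv d)" unfolding T_def by (rule smooth_transition[OF d chart_mem])
  have S: "open S"
    unfolding S_def by (rule continuous_open_preimage[OF smooth_on_imp_continuous_on[OF sm] _ T]) simp
  have mem: "\<gamma> t \<in> fst d" if "t \<in> S" for t using that im by (auto simp: S_def)
  have "\<gamma> 0 \<in> fst d" using \<epsilon> im by (auto simp: image_subset_iff)
  then have S0: "0 \<in> S" using w(2) \<epsilon> assms by (auto simp: S_def T_def)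
  \<comment> \<open>Membership in \<open>S\<close> only concerns the coordinates of the curve;
    injectivity of the chart \<open>d\<close> carries it back to the point itself.\<close>
  have SU: "\<gamma> ` S \<subseteq> U"
  proof
    fix m assume "m \<in> \<gamma> ` S"
    then obtain t where t: "t \<in> S" "m = \<gamma> t" by blast
    then obtain y where y: "y \<in> fst d \<inter> U" "snd d (\<gamma> t) = snd d y" by (auto simp: S_def T_def)
    then have "\<gamma> t = y" using mem[OF t(1)] inj_on_chart[OF d] by (auto dest: inj_onD)
    then show "m \<in> U" using y t by simp
  qed
  have "smooth_on S ((\<phi> \<circ> chart_inv d) \<circ> (snd d \<circ> \<gamma>))"
    by (rule smooth_on_compose[OF S T \<sigma> smooth_on_subset[OF sm]]) (auto simp: S_def)
  then have "smooth_on S (\<phi> \<circ> \<gamma>)"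
    by (subst smooth_on_cong[OF S, of _ "(\<phi> \<circ> chart_inv d) \<circ> (snd d \<circ> \<gamma>)"]) (auto simp: mem)
  then have "\<phi> \<circ> \<gamma> differentiable at 0"
    using smooth_on_has_derivative[OF _ S0] differentiable_def by blast
  then have "(\<phi> \<circ> \<gamma> has_vector_derivative vector_derivative (\<phi> \<circ> \<gamma>) (at 0)) (at 0)"
    using vector_derivative_works by blast
  from velocity_eq_tangent_vector[OF w(2) S S0 SU this] w(1)
  show "w \<in> range (tangent_vector q)" by blast
next
  fix w assume "w \<in> range (tangent_vector q)"
  then obtain v where w: "w = coord_vector A c q v" using coord_vector_eq[OF assms] by auto
  obtain \<epsilon> where \<epsilon>: "\<epsilon> > 0" "\<And>t. \<bar>t\<bar> < \<epsilon> \<Longrightarrow> \<phi> q + t *\<^sub>R v \<in> \<phi> ` U"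
    using line_in_chart[OF assms] by blast
  have lin: "smooth_on {-\<epsilon><..<\<epsilon>} (\<lambda>t. \<phi> q + t *\<^sub>R v)"
    unfolding smooth_on_def
    by (intro allI C_on_add C_on_const C_on_bounded_linear bounded_linear_scaleR_left) simp
  have "smooth_on {-\<epsilon><..<\<epsilon>} (\<phi> \<circ> (\<lambda>t. \<psi> (\<phi> q + t *\<^sub>R v)))"
    by (rule iffD1[OF smooth_on_cong lin]) (use \<epsilon> in auto)
  then have "smooth_curve A (\<lambda>t. \<psi> (\<phi> q + t *\<^sub>R v))"
    unfolding smooth_curve_def using \<epsilon> chart_mem by (intro bexI[of _ c] exI[of _ \<epsilon>]) auto
  then show "w \<in> tangent_space A q"
    unfolding w coord_vector_def tangent_space_def using assms
    by (auto intro!: exI[of _ "\<lambda>t. \<psi> (\<phi> q + t *\<^sub>R v)"])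
qed

section \<open>Vector fields and Lie brackets in coordinates\<close>

definition local_field :: "('a \<Rightarrow> 'a tangent) \<Rightarrow> 'b \<Rightarrow> 'b" where
  "local_field X x = components (X (\<psi> x))"

lemma chart_domain: "m \<in> U \<Longrightarrow> m \<in> \<Union> (fst ` A)"
  using chart_mem by auto

lemma vector_field_eq:
  assumes "smooth_vector_field A X" "m \<in> U"
  shows "X m = tangent_vector m (local_field X (\<phi> m))"
proof -
  have "X m \<in> range (tangent_vector m)"
    using assms chart_domain[OF assms(2)] tangent_space_eq[OF assms(2)]
    by (auto simp: smooth_vector_field_def)
  then show ?thesis using assms(2) by (auto simp: local_field_def)
qed

text \<open>Each component is the field applied to a coordinate function, hence smooth near every
  point; the neighbourhoods are glued.\<close>

lemma smooth_on_local_field: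
  assumes "smooth_vector_field A X"
  shows "smooth_on (\<phi> ` U) (local_field X)"
  unfolding local_field_def components_def
proof (intro smooth_on_sum open_chart_image smooth_on_bilinear[OF bounded_bilinear_scaleR] smooth_on_const)
  fix b :: 'b
  show "smooth_on (\<phi> ` U) (\<lambda>x. X (\<psi> x) (\<lambda>m. \<phi> m \<bullet> b))"
  proof (rule smooth_on_locally[OF open_chart_image])
    fix x assume x: "x \<in> \<phi> ` U"
    then have q: "\<psi> x \<in> U" by simp
    then have "smooth_at A (\<psi> x) (\<lambda>y. X y (\<lambda>m. \<phi> m \<bullet> b))"
      using assms chart_domain[OF q] smooth_at_coordinate[OF q] by (auto simp: smooth_vector_field_def)
    then show "\<exists>T. open T \<and> x \<in> T \<and> smooth_on T (\<lambda>x. X (\<psi> x) (\<lambda>m. \<phi> m \<bullet> b))"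
      using smooth_at_iff[OF q] x by (auto simp: o_def)
  qed
qed

lemma local_field_has_derivative:
  assumes "smooth_vector_field A X" "q \<in> U"
  shows "(local_field X has_derivative frechet_derivative (local_field X) (at (\<phi> q))) (at (\<phi> q))"
  using smooth_on_has_derivative[OF smooth_on_local_field[OF assms(1)]] assms(2) by blast

definition local_bracket :: "('a \<Rightarrow> 'a tangent) \<Rightarrow> ('a \<Rightarrow> 'a tangent) \<Rightarrow> 'b \<Rightarrow> 'b" where
  "local_bracket X Y x = frechet_derivative (local_field Y) (at x) (local_field X x)
     - frechet_derivative (local_field X) (at x) (local_field Y x)"

lemma vector_field_derivation:
  assumes X: "smooth_vector_field A X" and Y: "smooth_vector_field A Y" and q: "q \<in> U"
    and f: "smooth_at A q f"
  shows "X q (\<lambda>m. Y m f) =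
    frechet_derivative (\<lambda>z. frechet_derivative (f \<circ> \<psi>) (at z) (local_field Y (\<phi> q))) (at (\<phi> q))
      (local_field X (\<phi> q))
    + frechet_derivative (f \<circ> \<psi>) (at (\<phi> q))
        (frechet_derivative (local_field Y) (at (\<phi> q)) (local_field X (\<phi> q)))"
proof -
  obtain W where W: "open W" "\<phi> q \<in> W" "W \<subseteq> \<phi> ` U" "smooth_on W (f \<circ> \<psi>)"
    using f smooth_at_iff[OF q] by blast
  \<comment> \<open>The identity is required on all of \<open>W\<close>, since it is to be
    differentiated; \<open>f\<close> is smooth at each point of \<open>W\<close>.\<close>
  have val: "frechet_derivative (f \<circ> \<psi>) (at z) (local_field Y z) = ((\<lambda>m. Y m f) \<circ> \<psi>) z"
    if z: "z \<in> W" for z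
  proof -
    have zU: "\<psi> z \<in> U" "\<phi> (\<psi> z) = z" using z W(3) by auto
    have "smooth_at A (\<psi> z) f" using smooth_at_iff[OF zU(1)] W z zU(2) by metis
    then show ?thesis using vector_field_eq[OF Y zU(1)] zU by (simp add: tangent_vector_def)
  qed
  have "smooth_at A q (\<lambda>m. Y m f)"
    using Y f chart_domain[OF q] by (auto simp: smooth_vector_field_def)
  then have "X q (\<lambda>m. Y m f)
      = frechet_derivative ((\<lambda>m. Y m f) \<circ> \<psi>) (at (\<phi> q)) (local_field X (\<phi> q))"
    by (simp add: vector_field_eq[OF X q] tangent_vector_def)
  also have "frechet_derivative ((\<lambda>m. Y m f) \<circ> \<psi>) (at (\<phi> q)) =
    (\<lambda>h. frechet_derivative (\<lambda>z. frechet_derivative (f \<circ> \<psi>) (at z) (local_field Y (\<phi> q))) (at (\<phi> q)) h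
      + frechet_derivative (f \<circ> \<psi>) (at (\<phi> q)) (frechet_derivative (local_field Y) (at (\<phi> q)) h))"
    by (rule frechet_derivative_eq[OF has_derivative_transform_within_open[OF
          has_derivative_frechet_derivative_along[OF W(1,2,4) local_field_has_derivative[OF Y q]] W(1,2) val]])
  finally show ?thesis .
qed

text \<open>The second derivatives of \<open>f\<close> along the two fields cancel by symmetry, so
  the commutator acts on \<open>f\<close> as a first-order operator.\<close>

lemma lie_bracket_eq:
  assumes X: "smooth_vector_field A X" and Y: "smooth_vector_field A Y" and q: "q \<in> U"
  shows "lie_bracket A X Y q = tangent_vector q (local_bracket X Y (\<phi> q))"
proof
  fix f
  show "lie_bracket A X Y q f = tangent_vector q (local_bracket X Y (\<phi> q)) f"
  proof (cases "smooth_at A q f")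
    case True
    obtain W where W: "open W" "\<phi> q \<in> W" "smooth_on W (f \<circ> \<psi>)"
      using True smooth_at_iff[OF q] by blast
    have "linear (frechet_derivative (f \<circ> \<psi>) (at (\<phi> q)))"
      using smooth_at_has_derivative[OF q True] has_derivative_linear by blast
    then show ?thesis
      using True smooth_on_symmetric[OF W, of "local_field X (\<phi> q)" "local_field Y (\<phi> q)"]
      by (simp add: lie_bracket_def tangent_vector_def local_bracket_def linear_diff
          vector_field_derivation[OF X Y q True] vector_field_derivation[OF Y X q True])
  qed (simp add: lie_bracket_def tangent_vector_def)
qed

end

section \<open>The cotangent bundle in a chart\<close>

lemma sum_fun_apply: "(\<Sum>i\<in>I. f i) x = (\<Sum>i\<in>I. f i x)"
  by (induction I rule: infinite_finite_induct) (auto simp: zero_fun_def)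

context chart_in_atlas
begin

text \<open>Covectors are represented through the Euclidean inner product; the value 0 off the
  tangent space is the convention of \<open>cotangent_space\<close>.\<close>

definition covector :: "'a \<Rightarrow> 'b \<Rightarrow> 'a cotangent" where
  "covector q \<xi> = (\<lambda>v. if v \<in> tangent_space A q then \<xi> \<bullet> components v else 0)"

lemma covector_tangent_vector [simp]:
  "q \<in> U \<Longrightarrow> covector q \<xi> (tangent_vector q v) = \<xi> \<bullet> v"
  by (simp add: covector_def tangent_space_eq)

lemma covector_mem:
  assumes "q \<in> U" shows "covector q \<xi> \<in> cotangent_space A q"
proof -
  note lin = linear_tangent_vector[OF assms]
  have "covector q \<xi> (v + w) = covector q \<xi> v + covector q \<xi> w"
    if "v \<in> tangent_space A q" "w \<in> tangent_space A q" for v w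
    using that assms
    by (auto simp: tangent_space_eq linear_add[OF lin, symmetric] inner_add_right)
  moreover have "covector q \<xi> (a *\<^sub>R v) = a * covector q \<xi> v" if "v \<in> tangent_space A q" for a v
    using that assms
    by (auto simp: tangent_space_eq linear_scale[OF lin, symmetric])
  ultimately show ?thesis by (auto simp: cotangent_space_def covector_def)
qed

definition covector_components :: "'a \<Rightarrow> 'a cotangent \<Rightarrow> 'b" where
  "covector_components q p = (\<Sum>b\<in>Basis. p (tangent_vector q b) *\<^sub>R b)"

lemma covector_components_covector [simp]:
  "q \<in> U \<Longrightarrow> covector_components q (covector q \<xi>) = \<xi>"
  by (simp add: covector_components_def euclidean_representation)

lemma covector_covector_components:
  assumes q: "q \<in> U" and p: "p \<in> cotangent_space A q"
  shows "covector q (covector_components q p) = p"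
proof
  fix w
  note lin = linear_tangent_vector[OF q]
  show "covector q (covector_components q p) w = p w"
  proof (cases "w \<in> tangent_space A q")
    case True
    then obtain v where w: "w = tangent_vector q v" using tangent_space_eq[OF q] by auto
    have "linear (\<lambda>v. p (tangent_vector q v))"
      using p by (intro linearI) (auto simp: linear_add[OF lin] linear_scale[OF lin] cotangent_space_def tangent_space_eq[OF q])
    from linear_Basis_expansion[OF this, of v] show ?thesis
      using q by (simp add: w covector_components_def inner_sum_left inner_sum_right inner_commute mult.commute)
  next
    case False
    then show ?thesis using p by (simp add: covector_def cotangent_space_def)
  qed
qed

section \<open>Canonical coordinates and their coordinate vectors\<close>

abbreviation "\<Phi> \<equiv> cotangent_chart A c"

lemma cotangent_chart_mem: "q \<in> U \<Longrightarrow> (q, covector q \<xi>) \<in> fst \<Phi>"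
  by (simp add: cotangent_chart_def covector_mem)

lemma cotangent_chart_apply: "q \<in> U \<Longrightarrow> snd \<Phi> (q, p) = (\<phi> q, covector_components q p)"
  by (simp add: cotangent_chart_def coord_vector_eq covector_components_def)

lemma inj_on_cotangent_chart: "inj_on (snd \<Phi>) (fst \<Phi>)"
proof (rule inj_onI, clarify)
  fix q p q' p' assume mem: "(q, p) \<in> fst \<Phi>" "(q', p') \<in> fst \<Phi>" and eq: "snd \<Phi> (q, p) = snd \<Phi> (q', p')"
  then have U: "q \<in> U" "q' \<in> U" and p: "p \<in> cotangent_space A q" "p' \<in> cotangent_space A q'"
    by (auto simp: cotangent_chart_def)
  have "q = q'" using eq U inj_on_chart[OF chart_mem] by (auto simp: cotangent_chart_apply dest: inj_onD)
  moreover from this have "p = p'"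
    using eq U p covector_covector_components by (metis cotangent_chart_apply prod.inject)
  ultimately show "q = q' \<and> p = p'" by simp
qed

lemma chart_inv_cotangent_chart:
  assumes "q \<in> U" shows "chart_inv \<Phi> (\<phi> q, \<xi>) = (q, covector q \<xi>)"
  unfolding chart_inv_def
  by (rule inv_into_f_eq[OF inj_on_cotangent_chart cotangent_chart_mem[OF assms]])
    (simp add: cotangent_chart_apply assms)

lemma cotangent_chart_image: "\<phi> ` U \<times> UNIV \<subseteq> snd \<Phi> ` fst \<Phi>"
proof clarify
  fix m \<xi> assume "m \<in> U"
  then have "(\<phi> m, \<xi>) = snd \<Phi> (m, covector m \<xi>)" by (simp add: cotangent_chart_apply)
  then show "(\<phi> m, \<xi>) \<in> snd \<Phi> ` fst \<Phi>" using cotangent_chart_mem[OF \<open>m \<in> U\<close>] by blast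
qed

text \<open>Reduces coordinate vectors on the cotangent bundle to ordinary derivatives of a
  coordinate expression \<open>h'\<close> of \<open>h\<close>. Smoothness of \<open>h'\<close>
  ensures that \<open>velocity\<close> does not fall back to its default 0.\<close>

lemma cotangent_coord_vector_eq:
  assumes q: "q \<in> U" and W: "open W" "(\<phi> q, \<xi>) \<in> W" "W \<subseteq> \<phi> ` U \<times> UNIV"
    and h: "smooth_on W h'" "\<And>z. z \<in> W \<Longrightarrow> h (chart_inv \<Phi> z) = h' z"
    and D: "(h' has_derivative D) (at (\<phi> q, \<xi>))"
  shows "coord_vector (cotangent_atlas A) \<Phi> (q, covector q \<xi>) e h = D e"
proof -
  let ?l = "(q, covector q \<xi>)"
  let ?\<gamma> = "\<lambda>t::real. (\<phi> q, \<xi>) + t *\<^sub>R e"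
  have "smooth_on W (h \<circ> chart_inv \<Phi>)"
    by (rule iffD1[OF smooth_on_cong[OF W(1)] h(1)]) (simp add: h(2))
  moreover have "\<Phi> \<in> cotangent_atlas A" using chart_mem by (simp add: cotangent_atlas_def)
  moreover have l: "snd \<Phi> ?l = (\<phi> q, \<xi>)" using q by (simp add: cotangent_chart_apply)
  moreover have "W \<subseteq> snd \<Phi> ` fst \<Phi>" using W(3) cotangent_chart_image by blast
  ultimately have sm: "smooth_at (cotangent_atlas A) ?l h"
    unfolding smooth_at_def using W cotangent_chart_mem[OF q]
    by (intro bexI[of _ \<Phi>] conjI exI[of _ W]) auto
  have h'D: "(h' has_derivative D) (at (?\<gamma> 0))" using D by simp
  have "(?\<gamma> has_derivative (\<lambda>s. s *\<^sub>R e)) (at 0)" by (auto intro!: derivative_eq_intros)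
  from diff_chain_at[OF this h'D]
  have "((\<lambda>t. h' (?\<gamma> t)) has_derivative (\<lambda>s. D (s *\<^sub>R e))) (at 0)" by (simp add: o_def)
  moreover have "open (?\<gamma> -` W)" by (intro open_vimage W continuous_intros)
  ultimately have "((\<lambda>t. h (chart_inv \<Phi> (?\<gamma> t))) has_derivative (\<lambda>s. D (s *\<^sub>R e))) (at 0)"
    by (rule has_derivative_transform_within_open) (use W h(2) in auto)
  moreover have "(\<lambda>s. D (s *\<^sub>R e)) = (*) (D e)"
    using linear_scale[OF has_derivative_linear[OF D]] by (auto simp: mult.commute)
  ultimately have "((\<lambda>t. h (chart_inv \<Phi> (?\<gamma> t))) has_real_derivative D e) (at 0)"
    by (simp add: has_field_derivative_def)
  then show ?thesis
    using sm by (simp add: coord_vector_def velocity_def l chart_inv_cotangent_chart[OF q] DERIV_imp_deriv)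
qed

text \<open>In canonical coordinates the Hamiltonian is the pairing of the fibre variable with the
  local field, so its derivative has one fibre and one base term.\<close>

lemma coord_vector_vf_hamiltonian:
  assumes X: "smooth_vector_field A X" and q: "q \<in> U"
  shows "coord_vector (cotangent_atlas A) \<Phi> (q, covector q \<xi>) (u, \<eta>) (vf_hamiltonian X)
    = \<eta> \<bullet> local_field X (\<phi> q) + \<xi> \<bullet> frechet_derivative (local_field X) (at (\<phi> q)) u"
proof -
  let ?W = "\<phi> ` U \<times> (UNIV :: 'b set)"
  let ?h = "\<lambda>z. snd z \<bullet> (local_field X \<circ> fst) z"
  let ?F = "frechet_derivative (local_field X) (at (\<phi> q))"
  have W: "open ?W" by (intro open_Times open_chart_image open_UNIV)
  have "smooth_on ?W ?h"
    by (intro smooth_on_bilinear[OF bounded_bilinear_inner] smooth_on_bounded_linear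
        bounded_linear_snd smooth_on_compose[OF W open_chart_image smooth_on_local_field[OF X]]
        bounded_linear_fst W) auto
  moreover have "vf_hamiltonian X (chart_inv \<Phi> z) = ?h z" if z: "z \<in> ?W" for z
  proof -
    obtain m where "m \<in> U" "fst z = \<phi> m" using z by (auto simp: mem_Times_iff)
    moreover from this have "z = (\<phi> m, snd z)" by (simp add: prod_eq_iff)
    ultimately show ?thesis
      using chart_inv_cotangent_chart[of m "snd z"]
      by (simp add: vf_hamiltonian_def vector_field_eq[OF X])
  qed
  moreover have "(?h has_derivative (\<lambda>z. snd (\<phi> q, \<xi>) \<bullet> ?F (fst z) + snd z \<bullet> (local_field X \<circ> fst) (\<phi> q, \<xi>)))
      (at (\<phi> q, \<xi>))"
  proof (intro has_derivative_inner has_derivative_snd has_derivative_ident)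
    have "(local_field X has_derivative ?F) (at (fst (\<phi> q, \<xi>)))"
      using local_field_has_derivative[OF X q] by simp
    from diff_chain_at[OF has_derivative_fst[OF has_derivative_ident] this]
    show "(local_field X \<circ> fst has_derivative (\<lambda>z. ?F (fst z))) (at (\<phi> q, \<xi>))"
      by (simp add: o_def)
  qed
  ultimately show ?thesis
    using cotangent_coord_vector_eq[OF q W, of \<xi> ?h "vf_hamiltonian X"] q by simp
qed

text \<open>A function pulled back from the base is constant along fibres, so the fibre direction
  \<open>\<eta>\<close> drops out.\<close>

lemma coord_vector_comp_fst:
  assumes f: "smooth_at A q f" and q: "q \<in> U"
  shows "coord_vector (cotangent_atlas A) \<Phi> (q, covector q \<xi>) (u, \<eta>) (f \<circ> fst) = tangent_vector q u f"
proof -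
  obtain V where V: "open V" "\<phi> q \<in> V" "V \<subseteq> \<phi> ` U" "smooth_on V (f \<circ> \<psi>)"
    using f smooth_at_iff[OF q] by blast
  let ?W = "V \<times> (UNIV :: 'b set)"
  let ?F = "frechet_derivative (f \<circ> \<psi>) (at (\<phi> q))"
  have W: "open ?W" by (intro open_Times V open_UNIV)
  have sm: "smooth_on ?W ((f \<circ> \<psi>) \<circ> fst)"
    by (intro smooth_on_compose[OF W V(1,4)] smooth_on_bounded_linear bounded_linear_fst) auto
  have eq: "(f \<circ> fst) (chart_inv \<Phi> z) = ((f \<circ> \<psi>) \<circ> fst) z" if z: "z \<in> ?W" for z
  proof -
    obtain m \<zeta> where "m \<in> U" "z = (\<phi> m, \<zeta>)" using z V(3) by (cases z) auto
    then show ?thesis by (simp add: chart_inv_cotangent_chart)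
  qed
  have D: "((f \<circ> \<psi>) \<circ> fst has_derivative (\<lambda>z. ?F (fst z))) (at (\<phi> q, \<xi>))"
  proof -
    have "(f \<circ> \<psi> has_derivative ?F) (at (fst (\<phi> q, \<xi>)))"
      using smooth_at_has_derivative[OF q f] by simp
    from diff_chain_at[OF has_derivative_fst[OF has_derivative_ident] this]
    show ?thesis by (simp add: o_def)
  qed
  have "?W \<subseteq> \<phi> ` U \<times> UNIV" "(\<phi> q, \<xi>) \<in> ?W" using V by auto
  from cotangent_coord_vector_eq[OF q W this(2,1) sm eq D] show ?thesis
    using f by (simp add: tangent_vector_def o_def)
qed

text \<open>Hamiltonian fields are defined through a chart picked by \<open>SOME\<close>; working in that very chart
  avoids comparing canonical coordinates.\<close>

context
  fixes q
  assumes q: "q \<in> U" and chosen: "(SOME d. d \<in> A \<and> q \<in> fst d) = c"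
begin

lemma hamiltonian_field_apply:
  fixes \<xi> :: 'b
  assumes X: "smooth_vector_field A X"
  defines "D \<equiv> coord_vector (cotangent_atlas A) \<Phi> (q, covector q \<xi>)"
  shows "hamiltonian_field A (vf_hamiltonian X) (q, covector q \<xi>) g =
    (\<Sum>b\<in>Basis. (local_field X (\<phi> q) \<bullet> b) * D (b, 0) g
      - (\<xi> \<bullet> frechet_derivative (local_field X) (at (\<phi> q)) b) * D (0, b) g)"
proof -
  have "linear (frechet_derivative (local_field X) (at (\<phi> q)))"
    using local_field_has_derivative[OF X q] has_derivative_linear by blast
  then have "D (b, 0) (vf_hamiltonian X) = \<xi> \<bullet> frechet_derivative (local_field X) (at (\<phi> q)) b"
    "D (0, b) (vf_hamiltonian X) = local_field X (\<phi> q) \<bullet> b" for b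
    unfolding D_def coord_vector_vf_hamiltonian[OF X q] by (simp_all add: linear_0 inner_commute)
  then show ?thesis
    by (simp add: hamiltonian_field_def chosen D_def[symmetric] sum_fun_apply scaleR_fun_def)
qed

text \<open>Fibre derivatives of the Hamiltonians are components of the fields, so the sums over
  \<open>Basis\<close> reassemble into derivatives of each local field along the other.\<close>

lemma poisson_bracket_vf_hamiltonian:
  assumes X: "smooth_vector_field A X" and Y: "smooth_vector_field A Y"
  shows "poisson_bracket A (vf_hamiltonian X) (vf_hamiltonian Y) (q, covector q \<xi>)
    = \<xi> \<bullet> local_bracket X Y (\<phi> q)"
proof -
  let ?DX = "frechet_derivative (local_field X) (at (\<phi> q))"
  let ?DY = "frechet_derivative (local_field Y) (at (\<phi> q))"
  let ?x = "local_field X (\<phi> q)" and ?y = "local_field Y (\<phi> q)"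
  have lin: "linear ?DX" "linear ?DY"
    using local_field_has_derivative[OF X q] local_field_has_derivative[OF Y q]
      has_derivative_linear by blast+
  have e: "\<xi> \<bullet> h v = (\<Sum>b\<in>Basis. (v \<bullet> b) * (\<xi> \<bullet> h b))" if "linear h" for v and h :: "'b \<Rightarrow> 'b"
    using arg_cong[OF linear_Basis_expansion[OF that], of "inner \<xi>" v] by (simp add: inner_sum_right)
  have "poisson_bracket A (vf_hamiltonian X) (vf_hamiltonian Y) (q, covector q \<xi>)
    = (\<Sum>b\<in>Basis. (?x \<bullet> b) * (\<xi> \<bullet> ?DY b) - (\<xi> \<bullet> ?DX b) * (?y \<bullet> b))"
    unfolding poisson_bracket_def hamiltonian_field_apply[OF X] coord_vector_vf_hamiltonian[OF Y q]
    by (simp add: linear_0[OF lin(2)] inner_commute)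
  also have "\<dots> = \<xi> \<bullet> ?DY ?x - \<xi> \<bullet> ?DX ?y"
    unfolding e[OF lin(1), of ?y] e[OF lin(2), of ?x] by (simp add: sum_subtractf mult.commute)
  finally show ?thesis by (simp add: local_bracket_def inner_diff_right)
qed

text \<open>On functions pulled back from the base the fibre part of the Hamiltonian field acts as
  0, and its base part is \<open>X\<close>.\<close>

lemma pushforward_hamiltonian_field:
  assumes X: "smooth_vector_field A X" and f: "smooth_at A q f"
  shows "hamiltonian_field A (vf_hamiltonian X) (q, covector q \<xi>) (f \<circ> fst) = X q f"
proof -
  have expand: "tangent_vector q v f = (\<Sum>b\<in>Basis. (v \<bullet> b) * tangent_vector q b f)" for v
    using fun_cong[OF linear_Basis_expansion[OF linear_tangent_vector[OF q]], of v f]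
    by (simp add: sum_fun_apply scaleR_fun_def)
  have zero: "tangent_vector q 0 f = 0"
    using linear_0[OF linear_tangent_vector[OF q]] by (simp add: zero_fun_def)
  show ?thesis
    unfolding hamiltonian_field_apply[OF X] coord_vector_comp_fst[OF f q] vector_field_eq[OF X q]
      zero mult_zero_right diff_zero
    by (rule expand[symmetric])
qed

lemma pushforward_extremal_field:
  assumes f: "smooth_vector_field A f0" "smooth_vector_field A f1" "smooth_vector_field A f2"
  shows "pushforward A fst (q, covector q \<xi>) (extremal_field A f0 f1 f2 (q, covector q \<xi>)) =
    tangent_vector q (local_field f0 (\<phi> q)
      + (\<xi> \<bullet> local_bracket f0 f2 (\<phi> q) / (\<xi> \<bullet> local_bracket f2 f1 (\<phi> q))) *\<^sub>R local_field f1 (\<phi> q)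
      + (\<xi> \<bullet> local_bracket f1 f0 (\<phi> q) / (\<xi> \<bullet> local_bracket f2 f1 (\<phi> q))) *\<^sub>R local_field f2 (\<phi> q))"
  (is "?L = tangent_vector q ?v")
proof
  fix g
  show "?L g = tangent_vector q ?v g"
  proof (cases "smooth_at A q g")
    case True
    note lin = linear_tangent_vector[OF q]
    show ?thesis
      using True
      unfolding linear_add[OF lin] linear_scale[OF lin]
      by (simp add: pushforward_def extremal_field_def Let_def poisson_bracket_vf_hamiltonian f
          pushforward_hamiltonian_field[OF _ True] scaleR_fun_def f[THEN vector_field_eq, OF q])
  qed (simp add: pushforward_def tangent_vector_def)
qed

end

end

section \<open>Extremal velocities\<close>

context chart_in_atlas
begin

lemma affine_line_Ext:
  assumes dim: "DIM('b) = 4" and sys: "affine_system A f0 f1 f2" and q: "q \<in> U"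
    and chosen: "(SOME d. d \<in> A \<and> q \<in> fst d) = c"
    and dim3: "dim (D2_sq A f1 f2 q) = 3"
    and dim4: "dim (bracket_of A (velocity_set f0 f1 f2) (D2 f1 f2) q) = 4"
  shows "affine_line (Ext A f0 f1 f2 q)"
proof -
  \<comment> \<open>As a linear injection, \<open>T\<close> carries spans, dimensions and affine
    lines from the coordinate space to the operators at \<open>q\<close>.\<close>
  define T where "T = tangent_vector q"
  have lin: "linear T" and inj: "inj T"
    unfolding T_def by (rule linear_tangent_vector[OF q] inj_tangent_vector[OF q])+
  let ?F0 = "local_field f0" and ?F1 = "local_field f1" and ?F2 = "local_field f2"
  define x where "x = \<phi> q"
  have x: "x \<in> \<phi> ` U" using q by (simp add: x_def)
  define w where "w = local_bracket f1 f2 x"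
  define g1 where "g1 = local_bracket f0 f1 x"
  define g2 where "g2 = local_bracket f0 f2 x"
  have f: "smooth_vector_field A f0" "smooth_vector_field A f1" "smooth_vector_field A f2"
    and indep_sys: "\<And>m. m \<in> \<Union> (fst ` A) \<Longrightarrow> distinct [f0 m, f1 m, f2 m] \<and> independent {f0 m, f1 m, f2 m}"
    using sys by (auto simp: affine_system_def)
  \<comment> \<open>Independence is stated on the whole chart image, because the coefficients of
    fields in the frame have to be differentiated.\<close>
  have indep: "s = 0 \<and> t = 0" if z: "z \<in> \<phi> ` U" and eq: "s *\<^sub>R ?F1 z + t *\<^sub>R ?F2 z = 0" for z s t
  proof -
    have m: "\<psi> z \<in> U" and \<phi>: "\<phi> (\<psi> z) = z" using z by auto
    note linm = linear_tangent_vector[OF m]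
    have "s *\<^sub>R f1 (\<psi> z) + t *\<^sub>R f2 (\<psi> z) = tangent_vector (\<psi> z) (s *\<^sub>R ?F1 z + t *\<^sub>R ?F2 z)"
      by (simp add: linear_add[OF linm] linear_scale[OF linm] f[THEN vector_field_eq, OF m] \<phi>)
    then have eq0: "s *\<^sub>R f1 (\<psi> z) + t *\<^sub>R f2 (\<psi> z) = 0" by (simp add: eq linear_0[OF linm])
    have ne: "f1 (\<psi> z) \<noteq> f2 (\<psi> z)" and "independent {f0 (\<psi> z), f1 (\<psi> z), f2 (\<psi> z)}"
      using indep_sys[OF chart_domain[OF m]] by auto
    then have "independent {f1 (\<psi> z), f2 (\<psi> z)}" using independent_mono by blast
    \<comment> \<open>The two scalars become one coefficient function on the set, which is possible
      because the two vectors are distinct.\<close>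
    then have "(if v = f1 (\<psi> z) then s else t) = 0" if "v \<in> {f1 (\<psi> z), f2 (\<psi> z)}" for v
      by (rule independentD[OF _ _ subset_refl _ that]) (use eq0 ne in auto)
    from this[of "f1 (\<psi> z)"] this[of "f2 (\<psi> z)"] show ?thesis using ne by simp
  qed
  \<comment> \<open>One formula for both kinds of brackets: \<open>k = 0\<close> for fields in
    \<open>D2\<close>, \<open>k = 1\<close> for fields in \<open>velocity_set\<close>.\<close>
  have frame: "local_bracket X Y x - ((u1 x * v2 x - u2 x * v1 x) *\<^sub>R w + (k * v1 x) *\<^sub>R g1 + (k * v2 x) *\<^sub>R g2)
      \<in> span {?F1 x, ?F2 x}"
    if X: "smooth_vector_field A X" and Y: "smooth_vector_field A Y"
      and Xe: "\<And>z. z \<in> \<phi> ` U \<Longrightarrow> local_field X z = k *\<^sub>R ?F0 z + u1 z *\<^sub>R ?F1 z + u2 z *\<^sub>R ?F2 z"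
      and Ye: "\<And>z. z \<in> \<phi> ` U \<Longrightarrow> local_field Y z = v1 z *\<^sub>R ?F1 z + v2 z *\<^sub>R ?F2 z"
    for X Y k u1 u2 v1 v2
    unfolding local_bracket_def w_def g1_def g2_def
    by (rule frame_bracket[OF open_chart_image x Xe Ye indep])
      (use local_field_has_derivative[OF _ q, folded x_def] X Y f in auto)
  \<comment> \<open>The coefficient functions come from pointwise choice, with no regularity; their
    differentiability is derived inside \<open>frame_bracket\<close>.\<close>
  have D2_coeffs: "\<exists>v1 v2. \<forall>z\<in>\<phi> ` U. local_field Y z = v1 z *\<^sub>R ?F1 z + v2 z *\<^sub>R ?F2 z"
    if "Y \<in> vector_fields_in A (D2 f1 f2)" for Y
  proof -
    have "\<exists>a b. local_field Y z = a *\<^sub>R ?F1 z + b *\<^sub>R ?F2 z" if z: "z \<in> \<phi> ` U" for z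
    proof -
      have m: "\<psi> z \<in> U" and \<phi>: "\<phi> (\<psi> z) = z" using z by auto
      note linm = linear_tangent_vector[OF m]
      have "Y (\<psi> z) \<in> span {f1 (\<psi> z), f2 (\<psi> z)}"
        using \<open>Y \<in> vector_fields_in A (D2 f1 f2)\<close> chart_domain[OF m] by (auto simp: vector_fields_in_def D2_def)
      then obtain a b where "Y (\<psi> z) = a *\<^sub>R f1 (\<psi> z) + b *\<^sub>R f2 (\<psi> z)"
        by (auto simp: span_breakdown_eq[of _ "f1 (\<psi> z)"] span_singleton algebra_simps)
      also have "\<dots> = tangent_vector (\<psi> z) (a *\<^sub>R ?F1 z + b *\<^sub>R ?F2 z)"
        by (simp add: linear_add[OF linm] linear_scale[OF linm] f[THEN vector_field_eq, OF m] \<phi>)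
      finally show ?thesis using components_tangent_vector[OF m] unfolding local_field_def by metis
    qed
    then show ?thesis by metis
  qed
  have V_coeffs: "\<exists>u1 u2. \<forall>z\<in>\<phi> ` U. local_field X z = 1 *\<^sub>R ?F0 z + u1 z *\<^sub>R ?F1 z + u2 z *\<^sub>R ?F2 z"
    if "X \<in> vector_fields_in A (velocity_set f0 f1 f2)" for X
  proof -
    have "\<exists>a b. local_field X z = 1 *\<^sub>R ?F0 z + a *\<^sub>R ?F1 z + b *\<^sub>R ?F2 z" if z: "z \<in> \<phi> ` U" for z
    proof -
      have m: "\<psi> z \<in> U" and \<phi>: "\<phi> (\<psi> z) = z" using z by auto
      note linm = linear_tangent_vector[OF m]
      have "X (\<psi> z) \<in> velocity_set f0 f1 f2 (\<psi> z)"
        using \<open>X \<in> vector_fields_in A (velocity_set f0 f1 f2)\<close> chart_domain[OF m]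
        unfolding vector_fields_in_def by blast
      then obtain a b where "X (\<psi> z) = f0 (\<psi> z) + a *\<^sub>R f1 (\<psi> z) + b *\<^sub>R f2 (\<psi> z)"
        unfolding velocity_set_def by blast
      also have "\<dots> = tangent_vector (\<psi> z) (1 *\<^sub>R ?F0 z + a *\<^sub>R ?F1 z + b *\<^sub>R ?F2 z)"
        by (simp add: linear_add[OF linm] linear_scale[OF linm] f[THEN vector_field_eq, OF m] \<phi>)
      finally show ?thesis using components_tangent_vector[OF m] unfolding local_field_def by metis
    qed
    then show ?thesis by metis
  qed
  have absorb: "a \<in> span S" if "a - b \<in> span {?F1 x, ?F2 x}" "b \<in> span S" "{?F1 x, ?F2 x} \<subseteq> S" for a b S
    using span_add[OF subsetD[OF span_mono[OF that(3)] that(1)] that(2)] by simp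
  have bracket_eq: "lie_bracket A X Y q = T (local_bracket X Y x)"
    if "smooth_vector_field A X" "smooth_vector_field A Y" for X Y
    unfolding T_def x_def by (rule lie_bracket_eq[OF that q])
  have f_eq: "f1 q = T (?F1 x)" "f2 q = T (?F2 x)"
    unfolding T_def x_def by (rule vector_field_eq[OF _ q], rule f)+
  have D2_q: "D2 f1 f2 q = T ` span {?F1 x, ?F2 x}"
    unfolding D2_def f_eq linear_span_image[OF lin, symmetric] by simp
  have D2_bracket: "bracket_of A (D2 f1 f2) (D2 f1 f2) q \<subseteq> T ` span {?F1 x, ?F2 x, w}"
  proof
    fix v assume "v \<in> bracket_of A (D2 f1 f2) (D2 f1 f2) q"
    then obtain X Y where v: "v = lie_bracket A X Y q" and XY: "X \<in> vector_fields_in A (D2 f1 f2)"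
      "Y \<in> vector_fields_in A (D2 f1 f2)"
      unfolding bracket_of_def by blast
    then have sm: "smooth_vector_field A X" "smooth_vector_field A Y" by (auto simp: vector_fields_in_def)
    obtain u1 u2 where u: "\<And>z. z \<in> \<phi> ` U \<Longrightarrow> local_field X z = 0 *\<^sub>R ?F0 z + u1 z *\<^sub>R ?F1 z + u2 z *\<^sub>R ?F2 z"
      using D2_coeffs[OF XY(1)] by auto
    obtain v1 v2 where v12: "\<And>z. z \<in> \<phi> ` U \<Longrightarrow> local_field Y z = v1 z *\<^sub>R ?F1 z + v2 z *\<^sub>R ?F2 z"
      using D2_coeffs[OF XY(2)] by auto
    have "local_bracket X Y x \<in> span {?F1 x, ?F2 x, w}"
      by (rule absorb[OF frame[OF sm u v12]]) (auto intro: span_scale span_base)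
    then show "v \<in> T ` span {?F1 x, ?F2 x, w}" using bracket_eq[OF sm] v by simp
  qed
  have V_bracket: "bracket_of A (velocity_set f0 f1 f2) (D2 f1 f2) q \<subseteq> T ` span {?F1 x, ?F2 x, w, g1, g2}"
  proof
    fix v assume "v \<in> bracket_of A (velocity_set f0 f1 f2) (D2 f1 f2) q"
    then obtain X Y where v: "v = lie_bracket A X Y q" and XY: "X \<in> vector_fields_in A (velocity_set f0 f1 f2)"
      "Y \<in> vector_fields_in A (D2 f1 f2)"
      unfolding bracket_of_def by blast
    then have sm: "smooth_vector_field A X" "smooth_vector_field A Y" by (auto simp: vector_fields_in_def)
    obtain u1 u2 where u: "\<And>z. z \<in> \<phi> ` U \<Longrightarrow> local_field X z = 1 *\<^sub>R ?F0 z + u1 z *\<^sub>R ?F1 z + u2 z *\<^sub>R ?F2 z"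
      using V_coeffs[OF XY(1)] by auto
    obtain v1 v2 where v12: "\<And>z. z \<in> \<phi> ` U \<Longrightarrow> local_field Y z = v1 z *\<^sub>R ?F1 z + v2 z *\<^sub>R ?F2 z"
      using D2_coeffs[OF XY(2)] by auto
    have "local_bracket X Y x \<in> span {?F1 x, ?F2 x, w, g1, g2}"
      by (rule absorb[OF frame[OF sm u v12]]) (auto intro!: span_add intro: span_scale span_base)
    then show "v \<in> T ` span {?F1 x, ?F2 x, w, g1, g2}" using bracket_eq[OF sm] v by simp
  qed
  \<comment> \<open>Inclusions into spans suffice: with \<open>dim3\<close> and \<open>dim4\<close>
    they bound the dimensions of the spanning sets from below, while cardinality and
    \<open>DIM('b) = 4\<close> bound them from above.\<close>
  have dim_le: "dim S \<le> dim B" if S: "S \<subseteq> T ` span B" for S B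
  proof -
    obtain R where R: "R \<subseteq> span B" "S = T ` R" using S by (auto simp: subset_image_iff)
    then show ?thesis using dim_linear_inj_image[OF lin inj, of R] dim_mono[OF R(1)] by simp
  qed
  have D2_sq_subset: "D2_sq A f1 f2 q \<subseteq> T ` span {?F1 x, ?F2 x, w}"
  proof
    fix v assume "v \<in> D2_sq A f1 f2 q"
    then obtain a b where v: "v = T a + T b" "a \<in> span {?F1 x, ?F2 x}" "b \<in> span {?F1 x, ?F2 x, w}"
      using D2_bracket unfolding D2_sq_def D2_q by blast
    have "span {?F1 x, ?F2 x} \<subseteq> span {?F1 x, ?F2 x, w}" by (rule span_mono) auto
    with v(2,3) have "a + b \<in> span {?F1 x, ?F2 x, w}" by (auto intro: span_add)
    then show "v \<in> T ` span {?F1 x, ?F2 x, w}" using v(1) by (auto simp: linear_add[OF lin, symmetric])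
  qed
  have "dim {?F1 x, ?F2 x, w} \<le> card {?F1 x, ?F2 x, w}" by (rule dim_le_card') simp
  also have "\<dots> \<le> 3" by (auto simp: card_insert_if)
  finally have d3: "dim {?F1 x, ?F2 x, w} = 3" using dim_le[OF D2_sq_subset] dim3 by simp
  have d4: "dim {?F1 x, ?F2 x, w, g1, g2} = 4"
    using dim_le[OF V_bracket] dim4 dim_subset_UNIV[of "{?F1 x, ?F2 x, w, g1, g2}"] dim by simp
  \<comment> \<open>With \<open>D2_sq_subset\<close> this means that a covector vanishing on
    \<open>D2\<close> annihilates \<open>D2_sq\<close> exactly when it vanishes on
    \<open>w\<close>.\<close>
  have w_mem: "T w \<in> D2_sq A f1 f2 q"
  proof -
    have "f1 \<in> vector_fields_in A (D2 f1 f2)" "f2 \<in> vector_fields_in A (D2 f1 f2)"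
      using f by (auto simp: vector_fields_in_def D2_def intro: span_base)
    then have "T w \<in> bracket_of A (D2 f1 f2) (D2 f1 f2) q"
      unfolding bracket_of_def w_def using bracket_eq[OF f(2,3)] by force
    moreover have "0 \<in> D2 f1 f2 q" by (simp add: D2_def span_zero)
    ultimately show ?thesis unfolding D2_sq_def by force
  qed
  define K where "K = {\<xi>. \<xi> \<bullet> ?F1 x = 0 \<and> \<xi> \<bullet> ?F2 x = 0 \<and> \<xi> \<bullet> w \<noteq> 0}"
  have annih: "(q, covector q \<xi>) \<in> annihilator A E \<longleftrightarrow> (\<forall>v\<in>E q. covector q \<xi> v = 0)" for \<xi> E
    using chart_domain[OF q] covector_mem[OF q]
    by (auto simp: annihilator_def cotangent_bundle_def)
  have cov: "covector q \<xi> (T v) = \<xi> \<bullet> v" for \<xi> v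
    unfolding T_def using q by simp
  have inner_span: "\<xi> \<bullet> v = 0" if "v \<in> span S" "\<forall>u\<in>S. \<xi> \<bullet> u = 0" for \<xi> v :: 'b and S
    using that(2) orthogonal_to_span[OF that(1), of \<xi>] by (auto simp: orthogonal_def)
  have K_iff: "(q, covector q \<xi>) \<in> annihilator A (D2 f1 f2) - annihilator A (D2_sq A f1 f2) \<longleftrightarrow> \<xi> \<in> K" for \<xi>
  proof -
    have 1: "(q, covector q \<xi>) \<in> annihilator A (D2 f1 f2) \<longleftrightarrow> \<xi> \<bullet> ?F1 x = 0 \<and> \<xi> \<bullet> ?F2 x = 0"
    proof
      assume "(q, covector q \<xi>) \<in> annihilator A (D2 f1 f2)"
      moreover have "T (?F1 x) \<in> D2 f1 f2 q" "T (?F2 x) \<in> D2 f1 f2 q"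
        unfolding D2_q by (auto intro: span_base)
      ultimately show "\<xi> \<bullet> ?F1 x = 0 \<and> \<xi> \<bullet> ?F2 x = 0" unfolding annih using cov by metis
    next
      assume "\<xi> \<bullet> ?F1 x = 0 \<and> \<xi> \<bullet> ?F2 x = 0"
      then have "\<xi> \<bullet> a = 0" if "a \<in> span {?F1 x, ?F2 x}" for a
        using inner_span[OF that, of \<xi>] by simp
      then show "(q, covector q \<xi>) \<in> annihilator A (D2 f1 f2)"
        unfolding annih D2_q by (auto simp: cov)
    qed
    have 2: "(q, covector q \<xi>) \<in> annihilator A (D2_sq A f1 f2) \<longleftrightarrow> \<xi> \<bullet> w = 0"
      if "\<xi> \<bullet> ?F1 x = 0 \<and> \<xi> \<bullet> ?F2 x = 0"
    proof
      assume "(q, covector q \<xi>) \<in> annihilator A (D2_sq A f1 f2)"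
      then show "\<xi> \<bullet> w = 0" unfolding annih using w_mem cov by metis
    next
      assume w0: "\<xi> \<bullet> w = 0"
      show "(q, covector q \<xi>) \<in> annihilator A (D2_sq A f1 f2)"
        unfolding annih
      proof
        fix v assume "v \<in> D2_sq A f1 f2 q"
        then obtain a where "v = T a" "a \<in> span {?F1 x, ?F2 x, w}" using D2_sq_subset by blast
        then show "covector q \<xi> v = 0" using inner_span[of a "{?F1 x, ?F2 x, w}" \<xi>] that w0 by (simp add: cov)
      qed
    qed
    show ?thesis using 1 2 by (auto simp: K_def)
  qed
  have neg: "local_bracket f2 f1 x = - w" "local_bracket f1 f0 x = - g1"
    by (simp_all add: w_def g1_def local_bracket_def)
  define P where "P \<xi> = ?F0 x + (\<xi> \<bullet> g2 / (\<xi> \<bullet> - w)) *\<^sub>R ?F1 x + (\<xi> \<bullet> - g1 / (\<xi> \<bullet> - w)) *\<^sub>R ?F2 x" for \<xi>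
  have push: "pushforward A fst (q, covector q \<xi>) (extremal_field A f0 f1 f2 (q, covector q \<xi>)) = T (P \<xi>)" for \<xi>
    unfolding pushforward_extremal_field[OF q chosen f, folded x_def, unfolded neg] T_def P_def g2_def ..
  have "Ext A f0 f1 f2 q = T ` {P \<xi> | \<xi>. \<xi> \<in> K}"
  proof (intro set_eqI iffI)
    fix v assume "v \<in> Ext A f0 f1 f2 q"
    then obtain p where v: "v = pushforward A fst (q, p) (extremal_field A f0 f1 f2 (q, p))"
      and p: "(q, p) \<in> annihilator A (D2 f1 f2) - annihilator A (D2_sq A f1 f2)"
      unfolding Ext_def by auto
    then have "p \<in> cotangent_space A q" by (auto simp: annihilator_def cotangent_bundle_def)
    then obtain \<xi> where \<xi>: "p = covector q \<xi>" using covector_covector_components[OF q] by metis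
    have "v = T (P \<xi>)" "\<xi> \<in> K" using v p push K_iff unfolding \<xi> by auto
    then show "v \<in> T ` {P \<xi> | \<xi>. \<xi> \<in> K}" by blast
  next
    fix v assume "v \<in> T ` {P \<xi> | \<xi>. \<xi> \<in> K}"
    then obtain \<xi> where \<xi>: "v = T (P \<xi>)" "\<xi> \<in> K" by blast
    then show "v \<in> Ext A f0 f1 f2 q"
      unfolding Ext_def using push[of \<xi>] K_iff[of \<xi>]
      by (intro CollectI exI[of _ "(q, covector q \<xi>)"]) simp
  qed
  moreover have "affine_line {P \<xi> | \<xi>. \<xi> \<in> K}"
    using affine_line_of_annihilator[OF d3 d4 indep[OF x], of "?F0 x"] by (simp add: P_def K_def)
  ultimately show ?thesis using affine_line_linear_image[OF lin inj] by simp
qed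

end

theorem proposition3:
  fixes M :: "'m topology"
    and A :: "('m, real ^ 4) chart set"
    and f0 f1 f2 :: "'m \<Rightarrow> 'm tangent"
    and q :: 'm
  assumes "smooth_manifold M A"
    and "affine_system A f0 f1 f2"
    and "q \<in> topspace M"
    and "dim (D2_sq A f1 f2 q) = 3"
    and "dim (bracket_of A (velocity_set f0 f1 f2) (D2 f1 f2) q) = 4"
  shows "affine_line (Ext A f0 f1 f2 q)"
proof -
  \<comment> \<open>This is the very chart that \<open>hamiltonian_field\<close> chooses over
    \<open>q\<close>, so \<open>c_def\<close> discharges the premise \<open>chosen\<close>.\<close>
  define c where "c = (SOME d. d \<in> A \<and> q \<in> fst d)"
  have "\<Union> (fst ` A) = topspace M"
    using assms(1) by (simp add: smooth_manifold_def split_beta)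
  then have "\<exists>d. d \<in> A \<and> q \<in> fst d" using assms(3) by blast
  then have c: "c \<in> A" "q \<in> fst c" unfolding c_def by (metis (mono_tags, lifting) someI_ex)+
  interpret smooth_atlas A by (rule smooth_manifold_imp_smooth_atlas[OF assms(1)])
  interpret chart_in_atlas A c by unfold_locales (rule c)
  show ?thesis
    by (rule affine_line_Ext[OF _ assms(2) c(2) c_def[symmetric] assms(4,5)]) simp
qed

end
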